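(* For every set superpartition $I$ of bidegree $(n,m)$, we have $$e_I=\sum_{K\sqsubseteq I}\mu(\hat 0_{n,m},K)\,p_K,\qquad p_I=\frac{1}{\mu(\hat 0_{n,m},I)}\sum_{K\sqsubseteq I}\mu(K,I)\,e_K,$$ $$h_I=\sum_{K\sqsubseteq I}|\mu(\hat 0_{n,m},K)|\,p_K,\qquad p_I=\frac{1}{|\mu(\hat 0_{n,m},I)|}\sum_{K\sqsubseteq I}\mu(K,I)\,h_K,$$ $$e_I=\sum_{K\sqsubseteq I}(-1)^K\sum_{L\sqsubseteq K}\mu(L,K)\,h_L,\qquad h_I=\sum_{K\sqsubseteq I}(-1)^K\sum_{L\sqsubseteq K}\mu(L,K)\,e_L,$$ where $K,L$ range over partial set supercompositions of bidegree $(n,m)$.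
   Context: Combinatorial objects. $[n]=\{1,\dots,n\}$, $[n]_0=[n]\cup\{0\}$, and $A^+=A\setminus\{0\}$. For $0\le m\le n+1$, a partial set supercomposition of bidegree $(n,m)$ (degree $n$, fermionic degree $m$) is a tuple $K=(K_1,\dots,K_q)$ of nonempty subsets of $[n]_0$ (blocks) such that $K_1^+\cup\dots\cup K_q^+=[n]$, $K_i\cap K_j\subseteq\{0\}$ for $i\ne j$, $0\in K_i$ exactly for $i\le m$ (these are the fermionic blocks), and the nonfermionic blocks $K_{m+1},\dots,K_q$ are ordered by increasing minimum. $s\mathcal C_{n,m}$ is the set of these. The sign of $K=(K_1,\dots,K_q)$ is $(-1)^K:=\prod_{i=1}^q(-1)^{|K_i|-1}$. A set superpartition is a partial set supercomposition $I=(I_1,\dots,I_k)$ with $I_i\ne I_j$ and $\min(I_i\setminus I_j)<\min(I_j\setminus I_i)$ for all $i<j$, where $\min(\emptyset):=0$. For $K,L\in s\mathcal C_{n,m}$ write $K\sqsubseteq L$ if, for every $i\in[m]$, the $i$th fermionic block of $L$ is the union of the $i$th fermionic block of $K$ with some (possibly no) nonfermionic blocks of $K$, and each nonfermionic block of $L$ is a union of nonfermionic blocks of $K$. This is a partial order making $s\mathcal C_{n,m}$ a meet-semilattice, with meet denoted $\sqcap$ and least element $\hat 0_{n,m}=(\{0\},\dots,\{0\},\{1\},\dots,\{n\})$ ($m$ copies of $\{0\}$). $\mu$ is the Möbius function of the poset $(s\mathcal C_{n,m},\sqsubseteq)$: $\mu(K,K)=1$ and $\mu(K,L)=-\sum_{K\sqsubseteq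 N\sqsubset L}\mu(K,N)$ if $K\sqsubset L$. For a tuple of sets $N=(N_1,\dots,N_r)$, $N!=|N_1|!\cdots|N_r|!$ (the element $0$ is counted in the cardinalities). Functions. Let $\mathcal A$ be the $\mathbb Q$-algebra of formal power series of bounded degree in variables $x_1,x_2,\dots$ and $\theta_1,\theta_2,\dots$ subject only to $x_i\theta_j=\theta_jx_i$ and $\theta_i\theta_j=-\theta_j\theta_i$ for all $i,j$ (so $\theta_i^2=0$ and the $x_i$ do not commute with each other). For $K\in s\mathcal C_{n,m}$, each function below is a sum in $\mathcal A$ over words $\theta_{a_1}\cdots\theta_{a_m}x_{b_1}\cdots x_{b_n}$ with positive integer indices: - $M(K)$ is the set of words with, for $i\in[m]$, $a_i=b_j$ iff $j\in K_i^+$, and, for $i,j\in[n]$, $b_i=b_j$ iff $i,j$ lie in the same block of $K$. - $p_K$ is the sum of all words such that $a_i=b_j$ whenever $i\in[m]$, $j\in K_i^+$, and $b_i=b_j$ whenever $i,j\in[n]$ lie in the same block of $K$. - $e_K$ is the sum of all words such that $a_i\ne b_j$ whenever $i\in[m]$, $j\in K_i^+$, and $b_i\neq b_j$ whenever $i\ne j$ in $[n]$ lie in the same block of $K$. - $h_K=\sum_u c_u\,u$, over all words $u$ with $a_1,\dots,a_m$ pairwise distinct and such that $\{a_1,\dots,a_m\}\setminus\{b_1,\dots,b_n\}$ has at most one element, where $c_u=(K\sqcap L)!$ and $L$ is the unique element of $s\mathcal C_{n,m}$ with $u\in M(L)$. *)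

theory Defs
  imports Complex_Main
begin

section \<open>The algebra of formal power series in the variables \<open>x\<close> and \<open>\<theta>\<close>\<close>

text \<open>
  A monomial in normal form is \<open>\<theta>\<^sub>s\<^sub>1 \<cdots> \<theta>\<^sub>s\<^sub>r x\<^sub>w\<^sub>1 \<cdots> x\<^sub>w\<^sub>k\<close> with \<open>s\<^sub>1 < \<dots> < s\<^sub>r\<close>; it is encoded as the
  pair of the finite set \<open>{s\<^sub>1, \<dots>, s\<^sub>r}\<close> and the list \<open>w\<close>, all indices being positive.  By the
  defining relations every monomial is plus or minus a unique normal form or zero, so a series
  is its coefficient function on normal forms.
\<close>

typedef ncseries =
  "{f :: nat set \<times> nat list \<Rightarrow> rat.
      (\<forall>S w. f (S, w) \<noteq> 0 \<longrightarrow> finite S \<and> 0 \<notin> S \<and> 0 \<notin> set w) \<and>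
      (\<exists>d. \<forall>S w. f (S, w) \<noteq> 0 \<longrightarrow> card S + length w \<le> d)}"
  morphisms coeff Abs_ncseries
  by (rule exI[of _ "\<lambda>_. 0"]) auto

lemma ncseries_eqI: "(\<And>S w. coeff f (S, w) = coeff g (S, w)) \<Longrightarrow> f = g"
  by (metis coeff_inject ext surj_pair)

lemma coeff_support: "coeff f (S, w) \<noteq> 0 \<Longrightarrow> finite S \<and> 0 \<notin> S \<and> 0 \<notin> set w"
  using coeff[of f] by auto

lemma coeff_infinite [simp]: "infinite S \<Longrightarrow> coeff f (S, w) = 0"
  using coeff_support by blast

lemma coeff_bounded: "\<exists>d. \<forall>S w. coeff f (S, w) \<noteq> 0 \<longrightarrow> card S + length w \<le> d"
  using coeff[of f] by auto

lemma coeff_Abs: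
  assumes "\<And>S w. f (S, w) \<noteq> 0 \<Longrightarrow> finite S \<and> 0 \<notin> S \<and> 0 \<notin> set w \<and> card S + length w \<le> d"
  shows "coeff (Abs_ncseries f) = f"
  using assms by (intro Abs_ncseries_inverse) blast

text \<open>
  For disjoint \<open>S\<close> and \<open>T\<close>, \<open>\<theta>\<^sub>S \<theta>\<^sub>T\<close> is the normal form of \<open>S \<union> T\<close> times this sign.
\<close>

definition shuffle_sign :: "nat set \<Rightarrow> nat set \<Rightarrow> rat" where
  "shuffle_sign S T = (-1) ^ card {(s, t) \<in> S \<times> T. t < s}"

definition conv :: "(nat set \<times> nat list \<Rightarrow> rat) \<Rightarrow> (nat set \<times> nat list \<Rightarrow> rat)
    \<Rightarrow> nat set \<times> nat list \<Rightarrow> rat" where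
  "conv f g = (\<lambda>(R, w). \<Sum>S\<in>Pow R. \<Sum>k\<le>length w.
     shuffle_sign S (R - S) * f (S, take k w) * g (R - S, drop k w))"

instantiation ncseries :: ab_group_add
begin

definition "0 = Abs_ncseries (\<lambda>_. 0)"
definition "f + g = Abs_ncseries (\<lambda>u. coeff f u + coeff g u)"
definition "- f = Abs_ncseries (\<lambda>u. - coeff f u)"
definition "(f :: ncseries) - g = f + - g"

lemma coeff_zero [simp]: "coeff 0 u = 0"
  unfolding zero_ncseries_def by (subst coeff_Abs) auto

lemma coeff_uminus [simp]: "coeff (- f) u = - coeff f u"
proof -
  obtain d where "\<forall>S w. coeff f (S, w) \<noteq> 0 \<longrightarrow> card S + length w \<le> d"
    using coeff_bounded by blast
  then show ?thesis
    unfolding uminus_ncseries_def by (subst coeff_Abs[where d = d]) (use coeff_support in auto)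
qed

lemma coeff_add [simp]: "coeff (f + g) u = coeff f u + coeff g u"
proof -
  obtain d d' where d: "\<forall>S w. coeff f (S, w) \<noteq> 0 \<longrightarrow> card S + length w \<le> d"
      "\<forall>S w. coeff g (S, w) \<noteq> 0 \<longrightarrow> card S + length w \<le> d'"
    using coeff_bounded by metis
  have "finite S \<and> 0 \<notin> S \<and> 0 \<notin> set w \<and> card S + length w \<le> d + d'"
    if "coeff f (S, w) + coeff g (S, w) \<noteq> 0" for S w
  proof (cases "coeff f (S, w) = 0")
    case True
    then have "coeff g (S, w) \<noteq> 0" using that by simp
    then show ?thesis using d(2) coeff_support[of g S w] by (meson trans_le_add2)
  next
    case False
    then show ?thesis using d(1) coeff_support[of f S w] by (meson trans_le_add1)
  qed
  then show ?thesis
    unfolding plus_ncseries_def by (subst coeff_Abs[where d = "d + d'"]) blast+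
qed

instance
proof
  fix f g h :: ncseries
  show "f + g + h = f + (g + h)" "f + g = g + f" "0 + f = f" "- f + f = 0"
    by (rule ncseries_eqI, simp)+
  show "f - g = f + - g" by (rule minus_ncseries_def)
qed

end

lemma coeff_minus [simp]: "coeff (f - g) u = coeff f u - coeff g u"
  unfolding minus_ncseries_def coeff_add coeff_uminus by (rule add_uminus_conv_diff)

lemma coeff_sum [simp]: "coeff (sum f A) u = (\<Sum>a\<in>A. coeff (f a) u)"
  by (induction A rule: infinite_finite_induct) auto

instantiation ncseries :: "{one, times}"
begin

definition "1 = Abs_ncseries (\<lambda>u. if u = ({}, []) then 1 else 0)"
definition "f * g = Abs_ncseries (conv (coeff f) (coeff g))"

instance ..

end

lemma coeff_one: "coeff 1 u = (if u = ({}, []) then 1 else 0)"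
  unfolding one_ncseries_def by (subst coeff_Abs[where d = 0]) (auto split: if_splits)

lemma coeff_mult: "coeff (f * g) (R, w) = (\<Sum>S\<in>Pow R. \<Sum>k\<le>length w.
    shuffle_sign S (R - S) * coeff f (S, take k w) * coeff g (R - S, drop k w))"
proof -
  obtain d d' where d: "\<forall>S w. coeff f (S, w) \<noteq> 0 \<longrightarrow> card S + length w \<le> d"
      "\<forall>S w. coeff g (S, w) \<noteq> 0 \<longrightarrow> card S + length w \<le> d'"
    using coeff_bounded by metis
  have "finite R \<and> 0 \<notin> R \<and> 0 \<notin> set w \<and> card R + length w \<le> d + d'"
    if nz: "conv (coeff f) (coeff g) (R, w) \<noteq> 0" for R w
  proof -
    have "(\<Sum>S\<in>Pow R. \<Sum>k\<le>length w. shuffle_sign S (R - S) *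
        coeff f (S, take k w) * coeff g (R - S, drop k w)) \<noteq> 0"
      using nz by (simp add: conv_def)
    then obtain S where S: "S \<in> Pow R" and "(\<Sum>k\<le>length w. shuffle_sign S (R - S) *
        coeff f (S, take k w) * coeff g (R - S, drop k w)) \<noteq> 0"
      by (rule sum.not_neutral_contains_not_neutral)
    then obtain k where "shuffle_sign S (R - S) *
        coeff f (S, take k w) * coeff g (R - S, drop k w) \<noteq> 0"
      by (metis (no_types, lifting) sum.not_neutral_contains_not_neutral)
    then have f: "coeff f (S, take k w) \<noteq> 0" and g: "coeff g (R - S, drop k w) \<noteq> 0"
      by simp_all
    have R: "S \<union> (R - S) = R" using S by blast
    have w: "set (take k w) \<union> set (drop k w) = set w"
      by (metis append_take_drop_id set_append)
    have fin: "finite S" "finite (R - S)" using coeff_support[OF f] coeff_support[OF g] by auto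
    have "card R = card S + card (R - S)"
      using card_Un_disjoint[OF fin] R by simp
    moreover have "card S + length (take k w) \<le> d" "card (R - S) + length (drop k w) \<le> d'"
      using d f g by blast+
    moreover have "length w = length (take k w) + length (drop k w)"
      by (metis append_take_drop_id length_append)
    ultimately have "card R + length w \<le> d + d'" by linarith
    moreover have "finite R" using R fin by (metis finite_Un)
    moreover have "0 \<notin> R" "0 \<notin> set w"
      using coeff_support[OF f] coeff_support[OF g] R w by blast+
    ultimately show ?thesis by blast
  qed
  then have "coeff (f * g) = conv (coeff f) (coeff g)"
    unfolding times_ncseries_def by (rule coeff_Abs)
  then show ?thesis by (simp add: conv_def)
qed

lemma shuffle_sign_empty [simp]: "shuffle_sign {} T = 1" "shuffle_sign S {} = 1"
  by (simp_all add: shuffle_sign_def)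

lemma shuffle_sign_Un_left:
  assumes "finite S" "finite T" "finite U" "S \<inter> T = {}"
  shows "shuffle_sign (S \<union> T) U = shuffle_sign S U * shuffle_sign T U"
proof -
  have "{(s, t) \<in> (S \<union> T) \<times> U. t < s} = {(s, t) \<in> S \<times> U. t < s} \<union> {(s, t) \<in> T \<times> U. t < s}"
    by auto
  moreover have "finite {(s, t) \<in> S \<times> U. t < s}" "finite {(s, t) \<in> T \<times> U. t < s}"
    using assms by (auto intro: finite_subset[of _ "S \<times> U"] finite_subset[of _ "T \<times> U"])
  moreover have "{(s, t) \<in> S \<times> U. t < s} \<inter> {(s, t) \<in> T \<times> U. t < s} = {}"
    using assms(4) by auto
  ultimately show ?thesis
    unfolding shuffle_sign_def by (simp add: card_Un_disjoint power_add)
qed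

lemma shuffle_sign_Un_right:
  assumes "finite S" "finite T" "finite U" "T \<inter> U = {}"
  shows "shuffle_sign S (T \<union> U) = shuffle_sign S T * shuffle_sign S U"
proof -
  have "{(s, t) \<in> S \<times> (T \<union> U). t < s} = {(s, t) \<in> S \<times> T. t < s} \<union> {(s, t) \<in> S \<times> U. t < s}"
    by auto
  moreover have "finite {(s, t) \<in> S \<times> T. t < s}" "finite {(s, t) \<in> S \<times> U. t < s}"
    using assms by (auto intro: finite_subset[of _ "S \<times> T"] finite_subset[of _ "S \<times> U"])
  moreover have "{(s, t) \<in> S \<times> T. t < s} \<inter> {(s, t) \<in> S \<times> U. t < s} = {}"
    using assms(4) by auto
  ultimately show ?thesis
    unfolding shuffle_sign_def by (simp add: card_Un_disjoint power_add)
qed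

lemma sum_Pow_assoc:
  fixes \<phi> :: "'a set \<Rightarrow> 'a set \<Rightarrow> 'a set \<Rightarrow> 'b::comm_monoid_add"
  assumes "finite R"
  shows "(\<Sum>S\<in>Pow R. \<Sum>T\<in>Pow S. \<phi> T (S - T) (R - S)) =
         (\<Sum>T\<in>Pow R. \<Sum>U\<in>Pow (R - T). \<phi> T U (R - T - U))"
proof -
  have "(\<Sum>S\<in>Pow R. \<Sum>T\<in>Pow S. \<phi> T (S - T) (R - S)) =
      (\<Sum>(S, T)\<in>(SIGMA S:Pow R. Pow S). \<phi> T (S - T) (R - S))"
    using assms by (subst sum.Sigma) (auto intro: finite_subset)
  also have "\<dots> = (\<Sum>(T, U)\<in>(SIGMA T:Pow R. Pow (R - T)). \<phi> T U (R - T - U))"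
  proof (rule sum.reindex_bij_witness[where i = "\<lambda>(T, U). (T \<union> U, T)" and j = "\<lambda>(S, T). (T, S - T)"])
    fix a assume "a \<in> (SIGMA S:Pow R. Pow S)"
    then obtain S T where a: "a = (S, T)" "S \<subseteq> R" "T \<subseteq> S" by auto
    then have "R - T - (S - T) = R - S" by auto
    then show "(case case a of (S, T) \<Rightarrow> (T, S - T) of (T, U) \<Rightarrow> \<phi> T U (R - T - U)) =
        (case a of (S, T) \<Rightarrow> \<phi> T (S - T) (R - S))"
      using a by simp
  qed auto
  also have "\<dots> = (\<Sum>T\<in>Pow R. \<Sum>U\<in>Pow (R - T). \<phi> T U (R - T - U))"
    using assms by (subst sum.Sigma) (auto intro: finite_subset)
  finally show ?thesis .
qed

lemma sum_atMost_assoc: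
  fixes \<psi> :: "nat \<Rightarrow> nat \<Rightarrow> 'b::comm_monoid_add"
  shows "(\<Sum>k\<le>n. \<Sum>l\<le>k. \<psi> l k) = (\<Sum>l\<le>n. \<Sum>j\<le>n - l. \<psi> l (l + j))"
proof -
  have "(\<Sum>k\<le>n. \<Sum>l\<le>k. \<psi> l k) = (\<Sum>(k, l)\<in>(SIGMA k:{..n}. {..k}). \<psi> l k)"
    by (subst sum.Sigma) auto
  also have "\<dots> = (\<Sum>(l, j)\<in>(SIGMA l:{..n}. {..n - l}). \<psi> l (l + j))"
    by (rule sum.reindex_bij_witness[where i = "\<lambda>(l, j). (l + j, l)" and j = "\<lambda>(k, l). (l, k - l)"]) auto
  also have "\<dots> = (\<Sum>l\<le>n. \<Sum>j\<le>n - l. \<psi> l (l + j))"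
    by (subst sum.Sigma) auto
  finally show ?thesis .
qed

lemma ncseries_mult_assoc: "(f * g) * h = f * (g * h :: ncseries)"
proof (rule ncseries_eqI)
  fix R :: "nat set" and w :: "nat list"
  show "coeff (f * g * h) (R, w) = coeff (f * (g * h)) (R, w)"
  proof (cases "finite R")
    case False
    then show ?thesis by simp
  next
    case True
    define n where "n = length w"
    define \<Psi> where "\<Psi> = (\<lambda>T U V l k. shuffle_sign T U * shuffle_sign T V * shuffle_sign U V *
      coeff f (T, take l w) * coeff g (U, drop l (take k w)) * coeff h (V, drop k w))"
    have "coeff (f * g * h) (R, w) = (\<Sum>S\<in>Pow R. \<Sum>k\<le>n. \<Sum>T\<in>Pow S. \<Sum>l\<le>k. \<Psi> T (S - T) (R - S) l k)"
    proof -
      have "shuffle_sign S (R - S) * coeff (f * g) (S, take k w) * coeff h (R - S, drop k w) =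
          (\<Sum>T\<in>Pow S. \<Sum>l\<le>k. \<Psi> T (S - T) (R - S) l k)" if "S \<in> Pow R" "k \<le> n" for S k
      proof -
        have "shuffle_sign S (R - S) = shuffle_sign T (R - S) * shuffle_sign (S - T) (R - S)"
          if "T \<in> Pow S" for T
        proof -
          have "T \<union> (S - T) = S" using that by auto
          moreover have "finite T" "finite (S - T)" "finite (R - S)" "T \<inter> (S - T) = {}"
            using that \<open>S \<in> Pow R\<close> True by (auto intro: finite_subset)
          ultimately show ?thesis using shuffle_sign_Un_left by metis
        qed
        moreover have "length (take k w) = k" using that n_def by simp
        moreover have "take l (take k w) = take l w" if "l \<le> k" for l
          using that by (simp add: min_def)
        ultimately show ?thesis
          unfolding coeff_mult sum_distrib_left sum_distrib_right
          by (intro sum.cong refl) (simp_all add: \<Psi>_def del: take_take)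
      qed
      then show ?thesis by (simp add: coeff_mult n_def)
    qed
    also have "\<dots> = (\<Sum>S\<in>Pow R. \<Sum>T\<in>Pow S. \<Sum>k\<le>n. \<Sum>l\<le>k. \<Psi> T (S - T) (R - S) l k)"
      by (intro sum.cong refl, subst sum.swap) simp
    also have "\<dots> = (\<Sum>T\<in>Pow R. \<Sum>U\<in>Pow (R - T). \<Sum>k\<le>n. \<Sum>l\<le>k. \<Psi> T U (R - T - U) l k)"
      using True by (rule sum_Pow_assoc)
    also have "\<dots> = (\<Sum>T\<in>Pow R. \<Sum>U\<in>Pow (R - T). \<Sum>l\<le>n. \<Sum>j\<le>n - l. \<Psi> T U (R - T - U) l (l + j))"
      by (simp add: sum_atMost_assoc)
    also have "\<dots> = (\<Sum>T\<in>Pow R. \<Sum>l\<le>n. \<Sum>U\<in>Pow (R - T). \<Sum>j\<le>n - l. \<Psi> T U (R - T - U) l (l + j))"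
      by (intro sum.cong refl, subst sum.swap) simp
    also have "\<dots> = coeff (f * (g * h)) (R, w)"
    proof -
      have "shuffle_sign T (R - T) * coeff f (T, take l w) * coeff (g * h) (R - T, drop l w) =
          (\<Sum>U\<in>Pow (R - T). \<Sum>j\<le>n - l. \<Psi> T U (R - T - U) l (l + j))"
        if "T \<in> Pow R" for T l
      proof -
        have "shuffle_sign T (R - T) = shuffle_sign T U * shuffle_sign T (R - T - U)"
          if "U \<in> Pow (R - T)" for U
        proof -
          have "U \<union> (R - T - U) = R - T" using that by auto
          moreover have "finite T" "finite U" "finite (R - T - U)" "U \<inter> (R - T - U) = {}"
            using that \<open>T \<in> Pow R\<close> True by (auto intro: finite_subset)
          ultimately show ?thesis using shuffle_sign_Un_right by metis
        qed
        moreover have "length (drop l w) = n - l" using n_def by simp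
        moreover have "take j (drop l w) = drop l (take (l + j) w)" for j
          by (simp add: take_drop add.commute)
        ultimately show ?thesis
          unfolding coeff_mult sum_distrib_left sum_distrib_right
          by (intro sum.cong refl) (simp_all add: \<Psi>_def add.commute del: take_drop drop_take)
      qed
      then show ?thesis by (simp add: coeff_mult n_def)
    qed
    finally show ?thesis .
  qed
qed

lemma sum_single:
  assumes "finite A" "a \<in> A" "\<And>x. x \<in> A \<Longrightarrow> x \<noteq> a \<Longrightarrow> f x = 0"
  shows "sum f A = (f a :: 'b::comm_monoid_add)"
  using assms by (metis sum.remove sum.neutral add.right_neutral DiffD1 DiffD2 insertI1)

instance ncseries :: ring_1
proof
  fix f g h :: ncseries
  show "f * g * h = f * (g * h)" by (rule ncseries_mult_assoc)
  show "(f + g) * h = f * h + g * h"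
    by (rule ncseries_eqI) (simp add: coeff_mult algebra_simps sum.distrib)
  show "f * (g + h) = f * g + f * h"
    by (rule ncseries_eqI) (simp add: coeff_mult algebra_simps sum.distrib)
  show "1 * f = f"
  proof (rule ncseries_eqI)
    fix R w
    show "coeff (1 * f) (R, w) = coeff f (R, w)"
    proof (cases "finite R")
      case True
      have "coeff (1 * f) (R, w) = (\<Sum>k\<le>length w. coeff 1 ({}, take k w) * coeff f (R, drop k w))"
        unfolding coeff_mult by (subst sum_single[where a = "{}"]) (auto simp: True coeff_one)
      also have "\<dots> = coeff f (R, w)"
        by (subst sum_single[where a = 0]) (auto simp: coeff_one)
      finally show ?thesis .
    qed simp
  qed
  show "f * 1 = f"
  proof (rule ncseries_eqI)
    fix R w
    show "coeff (f * 1) (R, w) = coeff f (R, w)"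
    proof (cases "finite R")
      case True
      have "coeff (f * 1) (R, w) = (\<Sum>k\<le>length w. coeff f (R, take k w) * coeff 1 ({}, drop k w))"
        unfolding coeff_mult by (subst sum_single[where a = R]) (auto simp: True coeff_one)
      also have "\<dots> = coeff f (R, w)"
        by (subst sum_single[where a = "length w"]) (auto simp: coeff_one)
      finally show ?thesis .
    qed simp
  qed
  show "(0 :: ncseries) \<noteq> 1"
    by (metis coeff_one coeff_zero zero_neq_one)
qed

definition scale :: "rat \<Rightarrow> ncseries \<Rightarrow> ncseries"  (infixr "*\<^sub>Q" 75) where
  "c *\<^sub>Q f = Abs_ncseries (\<lambda>u. c * coeff f u)"

lemma coeff_scale [simp]: "coeff (c *\<^sub>Q f) u = c * coeff f u"
proof -
  obtain d where "\<forall>S w. coeff f (S, w) \<noteq> 0 \<longrightarrow> card S + length w \<le> d"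
    using coeff_bounded by blast
  then show ?thesis
    unfolding scale_def by (subst coeff_Abs[where d = d]) (use coeff_support in auto)
qed

lemma scale_mult: "(c *\<^sub>Q f) * g = c *\<^sub>Q (f * g)" "f * (c *\<^sub>Q g) = c *\<^sub>Q (f * g)"
  by (auto intro!: ncseries_eqI simp: coeff_mult sum_distrib_left mult_ac)

interpretation ncseries: vector_space scale
  by standard (auto intro!: ncseries_eqI simp: algebra_simps)

text \<open>
  The variables are indexed by positive integers; the generators of index 0 are set to zero.
\<close>

definition theta :: "nat \<Rightarrow> ncseries" where
  "theta i = Abs_ncseries (\<lambda>u. if i > 0 \<and> u = ({i}, []) then 1 else 0)"

definition xvar :: "nat \<Rightarrow> ncseries" where
  "xvar i = Abs_ncseries (\<lambda>u. if i > 0 \<and> u = ({}, [i]) then 1 else 0)"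

lemma coeff_theta: "coeff (theta i) u = (if i > 0 \<and> u = ({i}, []) then 1 else 0)"
  unfolding theta_def by (subst coeff_Abs[where d = 1]) (auto split: if_splits)

lemma coeff_xvar: "coeff (xvar i) u = (if i > 0 \<and> u = ({}, [i]) then 1 else 0)"
  unfolding xvar_def by (subst coeff_Abs[where d = 1]) (auto split: if_splits)

lemma coeff_theta_mult:
  "coeff (theta i * f) (R, w) =
     (if i > 0 \<and> i \<in> R then shuffle_sign {i} (R - {i}) * coeff f (R - {i}, w) else 0)"
proof (cases "finite R \<and> i > 0 \<and> i \<in> R")
  case True
  have "coeff (theta i * f) (R, w) = (\<Sum>k\<le>length w.
      shuffle_sign {i} (R - {i}) * coeff (theta i) ({i}, take k w) * coeff f (R - {i}, drop k w))"
    unfolding coeff_mult using True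
    by (subst sum_single[where a = "{i}"]) (auto simp: coeff_theta)
  also have "\<dots> = shuffle_sign {i} (R - {i}) * coeff f (R - {i}, w)"
    using True by (subst sum_single[where a = 0]) (auto simp: coeff_theta)
  finally show ?thesis using True by simp
next
  case False
  then show ?thesis
    by (cases "finite R") (auto simp: coeff_mult coeff_theta intro!: sum.neutral)
qed

lemma coeff_mult_xvar:
  "coeff (f * xvar i) (R, w) = (if i > 0 \<and> w \<noteq> [] \<and> last w = i then coeff f (R, butlast w) else 0)"
proof (cases "finite R \<and> i > 0 \<and> w \<noteq> [] \<and> last w = i")
  case True
  then obtain v where w: "w = v @ [i]" by (metis append_butlast_last_id)
  have "coeff (f * xvar i) (R, w) = (\<Sum>k\<le>length w.
      coeff f (R, take k w) * coeff (xvar i) ({}, drop k w))"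
    unfolding coeff_mult using True
    by (subst sum_single[where a = R]) (auto simp: coeff_xvar)
  also have "\<dots> = coeff f (R, v)"
    by (subst sum_single[where a = "length v"])
       (use True w in \<open>auto simp: coeff_xvar Cons_eq_append_conv append_eq_Cons_conv\<close>)
  finally show ?thesis using True w by simp
next
  case False
  have last: "w \<noteq> [] \<and> last w = i" if "drop k w = [i]" for k using that
    by (metis append_take_drop_id last.simps last_appendR list.distinct(1) drop_Nil)
  show ?thesis using False
    by (cases "finite R") (auto simp: coeff_mult coeff_xvar dest: last intro!: sum.neutral)
qed

lemma shuffle_sign_singletons:
  assumes "i \<noteq> j" shows "shuffle_sign {i} {j} = - shuffle_sign {j} {i}"
proof -
  have "{(s, t) \<in> {a} \<times> {b}. t < s} = (if b < a then {(a, b)} else {})" for a b :: nat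
    by auto
  then show ?thesis using assms by (auto simp: shuffle_sign_def)
qed

lemma theta_anticommute: "theta i * theta j = - (theta j * theta i)"
proof (rule ncseries_eqI)
  fix R w
  show "coeff (theta i * theta j) (R, w) = coeff (- (theta j * theta i)) (R, w)"
  proof (cases "i > 0 \<and> j > 0 \<and> i \<noteq> j \<and> R = {i, j} \<and> w = []")
    case True
    then have "R - {i} = {j}" "R - {j} = {i}" by auto
    then show ?thesis
      using True shuffle_sign_singletons[of i j] by (simp add: coeff_theta_mult coeff_theta)
  next
    case False
    then show ?thesis by (auto simp: coeff_theta_mult coeff_theta)
  qed
qed

lemma theta_square: "theta i * theta i = 0"
  by (rule ncseries_eqI) (auto simp: coeff_theta_mult coeff_theta)

lemma xvar_theta_commute: "xvar i * theta j = theta j * xvar i"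
proof (rule ncseries_eqI)
  fix R w
  show "coeff (xvar i * theta j) (R, w) = coeff (theta j * xvar i) (R, w)"
  proof (cases "finite R")
    case True
    have "coeff (xvar i * theta j) (R, w) =
        (\<Sum>k\<le>length w. coeff (xvar i) ({}, take k w) * coeff (theta j) (R, drop k w))"
      unfolding coeff_mult by (subst sum_single[where a = "{}"]) (auto simp: True coeff_xvar)
    also have "\<dots> = (if w = [i] \<and> R = {j} \<and> i > 0 \<and> j > 0 then 1 else 0)"
    proof (cases "w = [i]")
      case True
      then show ?thesis by (auto simp: coeff_xvar coeff_theta)
    next
      case False
      then have "coeff (xvar i) ({}, take k w) * coeff (theta j) (R, drop k w) = 0" for k
        by (auto simp: coeff_xvar coeff_theta)
      then have "(\<Sum>k\<le>length w. coeff (xvar i) ({}, take k w) * coeff (theta j) (R, drop k w)) = 0"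
        by (intro sum.neutral ballI)
      then show ?thesis using False by simp
    qed
    also have "\<dots> = coeff (theta j * xvar i) (R, w)"
      by (auto simp: coeff_theta_mult coeff_xvar)
    finally show ?thesis .
  qed simp
qed


section \<open>Words and infinite sums of words\<close>

text \<open>
  The word \<open>\<theta>\<^sub>a\<^sub>1 \<cdots> \<theta>\<^sub>a\<^sub>m x\<^sub>b\<^sub>1 \<cdots> x\<^sub>b\<^sub>n\<close> is represented by the pair of lists \<open>(a, b)\<close>.
  Lists are indexed from 0, so \<open>b\<^sub>j\<close> is \<open>b ! (j - 1)\<close>.
\<close>

type_synonym word = "nat list \<times> nat list"

definition words :: "nat \<Rightarrow> nat \<Rightarrow> word set" where
  "words n m = {(a, b). length a = m \<and> length b = n \<and> 0 \<notin> set a \<and> 0 \<notin> set b}"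

definition eval_word :: "word \<Rightarrow> ncseries" where
  "eval_word = (\<lambda>(a, b). prod_list (map theta a) * prod_list (map xvar b))"

text \<open>
  Sums over infinite sets of words are formed coefficientwise; only finitely many words of a
  given bidegree contribute to the coefficient of a given monomial.
\<close>

definition word_sum :: "word set \<Rightarrow> (word \<Rightarrow> rat) \<Rightarrow> ncseries" where
  "word_sum W c = Abs_ncseries
     (\<lambda>u. \<Sum>v | v \<in> W \<and> coeff (eval_word v) u \<noteq> 0. c v * coeff (eval_word v) u)"

lemma coeff_prod_xvar:
  "coeff (prod_list (map xvar b)) (R, w) = (if R = {} \<and> w = b \<and> 0 \<notin> set b then 1 else 0)"
proof (induction b arbitrary: R w rule: rev_induct)
  case (snoc i b)
  show ?case
  proof (cases "w = []")
    case False
    then obtain v j where "w = v @ [j]" by (metis append_butlast_last_id)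
    then show ?thesis by (auto simp: coeff_mult_xvar snoc.IH)
  qed (simp add: coeff_mult_xvar)
qed (simp add: coeff_one)

lemma coeff_eval_word_nonzero:
  assumes "coeff (eval_word (a, b)) (R, w) \<noteq> 0"
  shows "R = set a \<and> distinct a \<and> w = b"
proof -
  have *: "coeff (prod_list (map theta a) * f) (R, w) \<noteq> 0 \<Longrightarrow>
      distinct a \<and> set a \<subseteq> R \<and> coeff f (R - set a, w) \<noteq> 0" for a f R
  proof (induction a arbitrary: R)
    case (Cons i a)
    have i: "i \<in> R" and nz: "coeff (prod_list (map theta a) * f) (R - {i}, w) \<noteq> 0"
      using Cons.prems by (auto simp: mult.assoc coeff_theta_mult split: if_splits)
    have "R - {i} - set a = R - set (i # a)" by auto
    then show ?case using Cons.IH[OF nz] i by auto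
  qed simp
  have "distinct a \<and> set a \<subseteq> R \<and> coeff (prod_list (map xvar b)) (R - set a, w) \<noteq> 0"
    using assms by (intro *) (simp add: eval_word_def)
  then have "distinct a \<and> set a \<subseteq> R \<and> R - set a = {} \<and> w = b"
    by (simp add: coeff_prod_xvar split: if_splits)
  then show ?thesis by blast
qed

lemma finite_contributing_words:
  "finite {v. v \<in> words n m \<and> coeff (eval_word v) (R, w) \<noteq> 0}"
proof (cases "finite R")
  case True
  have "{v. v \<in> words n m \<and> coeff (eval_word v) (R, w) \<noteq> 0} \<subseteq> {a. set a \<subseteq> R \<and> length a = m} \<times> {w}"
    by (auto simp: words_def dest: coeff_eval_word_nonzero)
  then show ?thesis
    using finite_lists_length_eq[OF True, of m] by (auto intro: finite_subset)
qed simp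

lemma coeff_word_sum:
  assumes "W \<subseteq> words n m"
  shows "coeff (word_sum W c) u =
    (\<Sum>v | v \<in> W \<and> coeff (eval_word v) u \<noteq> 0. c v * coeff (eval_word v) u)"
proof -
  have "finite S \<and> 0 \<notin> S \<and> 0 \<notin> set w \<and> card S + length w \<le> m + n"
    if nz: "(\<Sum>v | v \<in> W \<and> coeff (eval_word v) (S, w) \<noteq> 0. c v * coeff (eval_word v) (S, w)) \<noteq> 0"
    for S w
  proof -
    obtain v where v: "v \<in> W" "coeff (eval_word v) (S, w) \<noteq> 0"
      using sum.not_neutral_contains_not_neutral[OF nz] by blast
    obtain a b where ab: "v = (a, b)" by (cases v)
    have *: "S = set a" "distinct a" "w = b"
      using coeff_eval_word_nonzero[of a b S w] v(2) ab by simp_all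
    have "(a, b) \<in> words n m" using v ab assms by auto
    then show ?thesis using * by (auto simp: words_def distinct_card)
  qed
  then show ?thesis
    unfolding word_sum_def by (subst coeff_Abs[where d = "m + n"]) blast+
qed


section \<open>Partial set supercompositions and their order\<close>

text \<open>
  Tuples are lists indexed from 0: the fermionic blocks of \<open>K\<close> are \<open>K ! i\<close> for \<open>i < m\<close>, the
  nonfermionic ones are the entries of \<open>drop m K\<close>.
\<close>

definition supercompositions :: "nat \<Rightarrow> nat \<Rightarrow> nat set list set" where
  "supercompositions n m = {K. m \<le> n + 1 \<and> m \<le> length K \<and>
     (\<forall>B\<in>set K. B \<noteq> {} \<and> B \<subseteq> {0..n}) \<and>
     (\<Union>B\<in>set K. B - {0}) = {1..n} \<and>
     (\<forall>i<length K. \<forall>j<length K. i \<noteq> j \<longrightarrow> K ! i \<inter> K ! j \<subseteq> {0}) \<and>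
     (\<forall>i<length K. 0 \<in> K ! i \<longleftrightarrow> i < m) \<and>
     sorted_wrt (\<lambda>A B. Min A < Min B) (drop m K)}"

definition min0 :: "nat set \<Rightarrow> nat" where
  "min0 A = (if A = {} then 0 else Min A)"

definition set_superpartitions :: "nat \<Rightarrow> nat \<Rightarrow> nat set list set" where
  "set_superpartitions n m = {I \<in> supercompositions n m.
     \<forall>i j. i < j \<and> j < length I \<longrightarrow>
       I ! i \<noteq> I ! j \<and> min0 (I ! i - I ! j) < min0 (I ! j - I ! i)}"

definition block_sign :: "nat set list \<Rightarrow> int" where
  "block_sign K = (\<Prod>B\<leftarrow>K. (-1) ^ (card B - 1))"

definition block_fact :: "nat set list \<Rightarrow> nat" where
  "block_fact K = (\<Prod>B\<leftarrow>K. fact (card B))"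

definition refines :: "nat \<Rightarrow> nat set list \<Rightarrow> nat set list \<Rightarrow> bool" where
  "refines m K L \<longleftrightarrow>
     (\<forall>i<m. \<exists>\<B> \<subseteq> set (drop m K). L ! i = K ! i \<union> \<Union>\<B>) \<and>
     (\<forall>C\<in>set (drop m L). \<exists>\<B> \<subseteq> set (drop m K). C = \<Union>\<B>)"

definition meet :: "nat \<Rightarrow> nat \<Rightarrow> nat set list \<Rightarrow> nat set list \<Rightarrow> nat set list" where
  "meet n m K L = (THE N. N \<in> supercompositions n m \<and> refines m N K \<and> refines m N L \<and>
     (\<forall>N'\<in>supercompositions n m. refines m N' K \<and> refines m N' L \<longrightarrow> refines m N' N))"

definition least_comp :: "nat \<Rightarrow> nat \<Rightarrow> nat set list" where
  "least_comp n m = replicate m {0} @ map (\<lambda>i. {i}) [1..<n + 1]"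

lemma refines_refl: "refines m K K"
proof -
  have "C \<in> set (drop m K) \<Longrightarrow> \<exists>\<B> \<subseteq> set (drop m K). C = \<Union>\<B>" for C
    by (rule exI[of _ "{C}"]) auto
  moreover have "\<exists>\<B> \<subseteq> set (drop m K). K ! i = K ! i \<union> \<Union>\<B>" for i
    by (rule exI[of _ "{}"]) auto
  ultimately show ?thesis unfolding refines_def by blast
qed

lemma refines_fermionic:
  "refines m K L \<Longrightarrow> i < m \<Longrightarrow> \<exists>\<B> \<subseteq> set (drop m K). L ! i = K ! i \<union> \<Union>\<B>"
  unfolding refines_def by simp

lemma refines_nonfermionic:
  "refines m K L \<Longrightarrow> C \<in> set (drop m L) \<Longrightarrow> \<exists>\<B> \<subseteq> set (drop m K). C = \<Union>\<B>"
  unfolding refines_def by simp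

lemma Union_of_Unions:
  assumes "\<forall>C\<in>\<C>. \<exists>\<B> \<subseteq> X. C = \<Union>\<B>"
  shows "\<exists>\<B> \<subseteq> X. \<Union>\<C> = \<Union>\<B>"
proof -
  obtain F where F: "\<forall>C\<in>\<C>. F C \<subseteq> X \<and> C = \<Union>(F C)"
    using bchoice[OF assms[unfolded Bex_def]] by auto
  then have "\<Union>\<C> = (\<Union>C\<in>\<C>. \<Union>(F C))" by simp
  also have "\<dots> = \<Union>(\<Union>(F ` \<C>))" by blast
  finally have "\<Union>\<C> = \<Union>(\<Union>(F ` \<C>))" .
  moreover have "\<Union>(F ` \<C>) \<subseteq> X" using F by (simp add: UN_least)
  ultimately show ?thesis by (intro exI[of _ "\<Union>(F ` \<C>)"] conjI)
qed

lemma refines_trans: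
  assumes "refines m K L" "refines m L N"
  shows "refines m K N"
proof -
  have union: "\<exists>\<B> \<subseteq> set (drop m K). \<Union>\<C> = \<Union>\<B>" if "\<C> \<subseteq> set (drop m L)" for \<C>
    using refines_nonfermionic[OF assms(1)] that by (intro Union_of_Unions ballI) (metis subsetD)
  have "\<exists>\<B> \<subseteq> set (drop m K). N ! i = K ! i \<union> \<Union>\<B>" if i: "i < m" for i
  proof -
    obtain \<A> where A: "\<A> \<subseteq> set (drop m K)" "L ! i = K ! i \<union> \<Union>\<A>"
      using refines_fermionic[OF assms(1) i] by metis
    obtain \<C> where C: "\<C> \<subseteq> set (drop m L)" "N ! i = L ! i \<union> \<Union>\<C>"
      using refines_fermionic[OF assms(2) i] by metis
    obtain \<B> where B: "\<B> \<subseteq> set (drop m K)" "\<Union>\<C> = \<Union>\<B>" using union[OF C(1)] by metis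
    have "N ! i = K ! i \<union> \<Union>(\<A> \<union> \<B>)" by (simp add: A(2) C(2) B(2) Un_assoc)
    moreover have "\<A> \<union> \<B> \<subseteq> set (drop m K)" using A(1) B(1) by simp
    ultimately show ?thesis by (intro exI[of _ "\<A> \<union> \<B>"] conjI)
  qed
  moreover have "\<exists>\<B> \<subseteq> set (drop m K). D = \<Union>\<B>" if D: "D \<in> set (drop m N)" for D
  proof -
    obtain \<C> where "\<C> \<subseteq> set (drop m L)" "D = \<Union>\<C>"
      using refines_nonfermionic[OF assms(2) D] by metis
    then show ?thesis using union by simp
  qed
  ultimately show ?thesis unfolding refines_def by simp
qed

lemma block_unique:
  assumes "K \<in> supercompositions n m" "A \<in> set K" "B \<in> set K" "x \<in> A" "x \<in> B" "x \<noteq> 0"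
  shows "A = B"
proof (rule ccontr)
  obtain i j where ij: "i < length K" "A = K ! i" "j < length K" "B = K ! j"
    using assms(2,3) by (metis in_set_conv_nth)
  assume "A \<noteq> B"
  then have "i \<noteq> j" using ij by auto
  then have "A \<inter> B \<subseteq> {0}" using ij assms(1) unfolding supercompositions_def by simp
  then show False using assms(4-6) by blast
qed

lemma nonfermionic_nonzero:
  assumes "K \<in> supercompositions n m" "B \<in> set (drop m K)"
  shows "0 \<notin> B" "B \<noteq> {}" "finite B" "B \<in> set K"
proof -
  obtain i where i: "i < length (drop m K)" "B = drop m K ! i"
    using assms(2) by (metis in_set_conv_nth)
  then have "B = K ! (m + i)" "m + i < length K" by auto
  then show "0 \<notin> B" using assms(1) unfolding supercompositions_def by simp
  show "B \<in> set K" using assms(2) by (rule in_set_dropD)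
  then show "B \<noteq> {}" "finite B"
    using assms(1) finite_subset[of B "{0..n}"] unfolding supercompositions_def by auto
qed

lemma refines_block:
  assumes "K \<in> supercompositions n m" "L \<in> supercompositions n m" "refines m K L"
    "refines m L K" "B \<in> set (drop m K)"
  shows "B \<in> set (drop m L)"
proof -
  obtain \<C> where C: "\<C> \<subseteq> set (drop m L)" "B = \<Union>\<C>"
    using refines_nonfermionic[OF assms(4,5)] by metis
  obtain C where "C \<in> \<C>" using C(2) nonfermionic_nonzero(2)[OF assms(1,5)] by blast
  then have CL: "C \<in> set (drop m L)" and CB: "C \<subseteq> B" using C by auto
  obtain \<B> where B: "\<B> \<subseteq> set (drop m K)" "C = \<Union>\<B>"
    using refines_nonfermionic[OF assms(3) CL] by metis
  obtain B' where B': "B' \<in> \<B>" using B(2) nonfermionic_nonzero(2)[OF assms(2) CL] by blast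
  then have B'K: "B' \<in> set (drop m K)" and "B' \<subseteq> C" using B by auto
  obtain x where "x \<in> B'" using nonfermionic_nonzero(2)[OF assms(1) B'K] by blast
  then have "x \<in> B'" "x \<in> B" "x \<noteq> 0"
    using \<open>B' \<subseteq> C\<close> CB nonfermionic_nonzero(1)[OF assms(1) B'K] by (auto intro: gr0I)
  then have "B' = B"
    using block_unique[OF assms(1)] nonfermionic_nonzero(4)[OF assms(1)] B'K assms(5) by blast
  then have "C = B" using \<open>B' \<subseteq> C\<close> CB by blast
  then show ?thesis using CL by simp
qed

lemma refines_antisym:
  assumes K: "K \<in> supercompositions n m" and L: "L \<in> supercompositions n m"
    and KL: "refines m K L" and LK: "refines m L K"
  shows "K = L"
proof -
  have len: "m \<le> length K" "m \<le> length L"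
    using K L unfolding supercompositions_def by auto
  have sub: "K ! i \<subseteq> L ! i" if "refines m K L" "i < m" for K L i
  proof -
    show ?thesis using refines_fermionic[OF that] by auto
  qed
  have "K ! i = L ! i" if "i < m" for i
    using sub[OF KL that] sub[OF LK that] by (rule equalityI)
  then have "take m K = take m L" using len by (intro nth_equalityI) simp_all
  moreover have "drop m K = drop m L"
  proof -
    have set: "set (drop m K) = set (drop m L)"
      using refines_block[OF K L KL LK] refines_block[OF L K LK KL] by blast
    have srt: "sorted_wrt (<) (map Min (drop m K))" "sorted_wrt (<) (map Min (drop m L))"
      using K L unfolding supercompositions_def by (auto simp: sorted_wrt_map)
    have "map Min (drop m K) = map Min (drop m L)"
      by (rule strict_sorted_equal[OF srt(2,1)]) (simp add: set)
    moreover have "inj_on Min (set (drop m K) \<union> set (drop m L))"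
    proof (rule inj_onI)
      fix A B assume "A \<in> set (drop m K) \<union> set (drop m L)" "B \<in> set (drop m K) \<union> set (drop m L)"
        and eq: "Min A = Min B"
      then have A: "A \<in> set (drop m K)" and B: "B \<in> set (drop m K)" using set by auto
      note a = nonfermionic_nonzero[OF K A] and b = nonfermionic_nonzero[OF K B]
      have "Min A \<in> A" using a(2,3) by simp
      moreover have "Min A \<in> B" unfolding eq using b(2,3) by simp
      ultimately show "A = B" using block_unique[OF K a(4) b(4)] a(1) by metis
    qed
    ultimately show ?thesis by (rule map_inj_on)
  qed
  ultimately have "take m K @ drop m K = take m L @ drop m L" by simp
  then show ?thesis by simp
qed

lemma length_supercomposition:
  assumes "K \<in> supercompositions n m"
  shows "length K \<le> m + n"
proof -
  have srt: "sorted_wrt (<) (map Min (drop m K))"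
    using assms unfolding supercompositions_def by (auto simp: sorted_wrt_map)
  have "Min B \<in> {1..n}" if "B \<in> set (drop m K)" for B
  proof -
    note b = nonfermionic_nonzero[OF assms that]
    have "Min B \<in> B" using b by simp
    then have "Min B \<noteq> 0" using b(1) by metis
    have "B \<subseteq> {0..n}" using assms b(4) unfolding supercompositions_def by blast
    then have "Min B \<le> n" using \<open>Min B \<in> B\<close> by auto
    then show ?thesis using \<open>Min B \<noteq> 0\<close> by simp
  qed
  then have sub: "set (map Min (drop m K)) \<subseteq> {1..n}" by auto
  have "length (drop m K) = card (set (map Min (drop m K)))"
    using distinct_card[of "map Min (drop m K)"] srt by (simp add: strict_sorted_iff)
  also have "\<dots> \<le> n" using card_mono[OF _ sub] by simp
  finally show ?thesis by simp
qed

lemma finite_supercompositions: "finite (supercompositions n m)"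
proof -
  have "supercompositions n m \<subseteq> {K. set K \<subseteq> Pow {0..n} \<and> length K \<le> m + n}"
    using length_supercomposition by (auto simp: supercompositions_def)
  then show ?thesis
    by (rule finite_subset) (rule finite_lists_length_le, simp)
qed

text \<open>
  The Moebius function of the poset of partial set supercompositions of bidegree \<open>(n, m)\<close>; its
  values are meaningful only on elements of this poset, and it is 0 on incomparable pairs.
\<close>

function mobius :: "nat \<Rightarrow> nat \<Rightarrow> nat set list \<Rightarrow> nat set list \<Rightarrow> int" where
  "mobius n m K L =
     (if K = L then 1
      else if K \<in> supercompositions n m \<and> L \<in> supercompositions n m \<and> refines m K L
      then - (\<Sum>N | N \<in> supercompositions n m \<and> refines m K N \<and> refines m N L \<and> N \<noteq> L.
                mobius n m K N)
      else 0)"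
  by pat_completeness auto
termination
proof (relation "Wellfounded.measure
    (\<lambda>(n, m, K, L). card {N \<in> supercompositions n m. refines m N L})", goal_cases)
  case (2 n m K L N)
  then have N: "N \<in> supercompositions n m" "refines m N L" "N \<noteq> L"
    and L: "L \<in> supercompositions n m" by auto
  have "{X \<in> supercompositions n m. refines m X N} \<subset> {X \<in> supercompositions n m. refines m X L}"
  proof
    show "{X \<in> supercompositions n m. refines m X N} \<subseteq> {X \<in> supercompositions n m. refines m X L}"
      using N refines_trans by blast
    have "\<not> refines m L N" using refines_antisym[OF N(1) L N(2)] N(3) by blast
    then show "{X \<in> supercompositions n m. refines m X N} \<noteq> {X \<in> supercompositions n m. refines m X L}"
      using L refines_refl by blast
  qed
  then show ?case using finite_supercompositions by (auto intro: psubset_card_mono)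
qed simp

declare mobius.simps [simp del]


section \<open>The functions M, p, e and h\<close>

definition same_block :: "nat set list \<Rightarrow> nat \<Rightarrow> nat \<Rightarrow> bool" where
  "same_block K i j \<longleftrightarrow> (\<exists>B\<in>set K. i \<in> B \<and> j \<in> B)"

definition M_words :: "nat \<Rightarrow> nat \<Rightarrow> nat set list \<Rightarrow> word set" where
  "M_words n m K = {(a, b) \<in> words n m.
     (\<forall>i<m. \<forall>j\<in>{1..n}. a ! i = b ! (j - 1) \<longleftrightarrow> j \<in> K ! i) \<and>
     (\<forall>i\<in>{1..n}. \<forall>j\<in>{1..n}. b ! (i - 1) = b ! (j - 1) \<longleftrightarrow> same_block K i j)}"

definition p_fun :: "nat \<Rightarrow> nat \<Rightarrow> nat set list \<Rightarrow> ncseries" where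
  "p_fun n m K = word_sum {(a, b) \<in> words n m.
     (\<forall>i<m. \<forall>j\<in>K ! i - {0}. a ! i = b ! (j - 1)) \<and>
     (\<forall>i\<in>{1..n}. \<forall>j\<in>{1..n}. same_block K i j \<longrightarrow> b ! (i - 1) = b ! (j - 1))} (\<lambda>_. 1)"

definition e_fun :: "nat \<Rightarrow> nat \<Rightarrow> nat set list \<Rightarrow> ncseries" where
  "e_fun n m K = word_sum {(a, b) \<in> words n m.
     (\<forall>i<m. \<forall>j\<in>K ! i - {0}. a ! i \<noteq> b ! (j - 1)) \<and>
     (\<forall>i\<in>{1..n}. \<forall>j\<in>{1..n}. i \<noteq> j \<and> same_block K i j \<longrightarrow> b ! (i - 1) \<noteq> b ! (j - 1))} (\<lambda>_. 1)"

definition word_comp :: "nat \<Rightarrow> nat \<Rightarrow> word \<Rightarrow> nat set list" where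
  "word_comp n m u = (THE L. L \<in> supercompositions n m \<and> u \<in> M_words n m L)"

definition h_fun :: "nat \<Rightarrow> nat \<Rightarrow> nat set list \<Rightarrow> ncseries" where
  "h_fun n m K = word_sum {(a, b) \<in> words n m. distinct a \<and> card (set a - set b) \<le> 1}
     (\<lambda>u. rat_of_nat (block_fact (meet n m K (word_comp n m u))))"

end

theory Submission
  imports "HOL-Library.Disjoint_Sets" "HOL-Combinatorics.Transposition" Defs
begin

text \<open>
  Adjoin to \<open>[n]\<close> one extra point for each of the \<open>m\<close> fermionic blocks.  Partial set
  supercompositions become the equivalence relations on these \<open>n + m\<close> points that keep the extra
  points apart, refinement becomes inclusion and the meet becomes intersection; a word
  \<open>\<theta>\<^sub>a x\<^sub>b\<close> gives the kernel of the map from points to indices.  Hence \<open>p\<^sub>K\<close> sums the words whose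
  kernel contains \<open>K\<close>, and \<open>e\<^sub>K\<close> those whose kernel meets \<open>K\<close> trivially.

  For an equivalence relation \<open>Q\<close>, adding the points one at a time shows
  \<open>\<Sum>\<^bsub>K \<subseteq> Q\<^esub> \<Prod>\<^bsub>B \<in> K\<^esub> z\<^bsup>|B| - 1\<^esup> (|B| - 1)! = \<Prod>\<^bsub>C \<in> Q\<^esub> \<Prod>\<^bsub>i < |C|\<^esub> (1 + i z)\<close>.  At \<open>z = -1\<close> the right-hand side is 1 or 0
  according to whether \<open>Q\<close> is trivial, so the weights are the values \<open>\<mu>(0, K)\<close>, and the expansion of
  \<open>e\<close> follows by comparing coefficients of words.  At \<open>z = 1\<close> it is \<open>Q!\<close>, which gives the expansion of
  \<open>h\<close>: the words with two indices of \<open>a\<close> missing from \<open>b\<close> cancel in pairs, since exchanging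
  these indices reverses the sign.  The other identities follow by Moebius inversion.
\<close>

section \<open>Weighted sums over partitions\<close>

text \<open>At \<open>z = -1\<close> this is the Moebius number from bottom to top of the partition
  lattice of a nonempty finite \<open>B\<close>, and at \<open>z = 1\<close> its absolute value.
  Keeping \<open>z\<close> free lets one summation formula serve both \<open>e\<close> and
  \<open>h\<close>.\<close>

definition block_weight :: "rat \<Rightarrow> 'a set \<Rightarrow> rat" where
  "block_weight z B = z ^ (card B - 1) * fact (card B - 1)"

text \<open>Being finer than \<open>Q\<close> is expressed blockwise, so that the ground set
  \<open>A\<close> can grow point by point while \<open>Q\<close> stays fixed.\<close>

definition fine_partitions :: "'a set \<Rightarrow> 'a rel \<Rightarrow> 'a set set set" where
  "fine_partitions A Q = {P. partition_on A P \<and> (\<forall>B\<in>P. B \<times> B \<subseteq> Q)}"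

lemma finite_fine_partitions: "finite A \<Longrightarrow> finite (fine_partitions A Q)"
  by (rule finite_subset[OF _ finitely_many_partition_on]) (auto simp: fine_partitions_def)

text \<open>The case \<open>C = {}\<close> is the one in which \<open>x\<close> forms a block of its own.\<close>

lemma fine_partitions_insert:
  assumes Q: "sym Q" "trans Q" "(x, x) \<in> Q" and x: "x \<notin> A"
  shows "bij_betw (\<lambda>(P, C). insert (insert x C) (P - {C}))
    (SIGMA P:fine_partitions A Q. insert {} {C \<in> P. C \<subseteq> Q `` {x}}) (fine_partitions (insert x A) Q)"
\<comment> \<open>The inverse takes \<open>x\<close> out of its block \<open>D\<close> and returns
  the remainder as \<open>C\<close>; subtracting \<open>{{}}\<close> discards the remainder when
  \<open>x\<close> was alone.\<close>
proof (rule bij_betw_byWitness[where f' = "\<lambda>P. (let D = (THE D. D \<in> P \<and> x \<in> D) in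
    ((P - {D}) \<union> ({D - {x}} - {{}}), D - {x}))"], goal_cases)
  case 1
  show ?case
  proof clarify
    fix P C assume P: "P \<in> fine_partitions A Q" and C: "C \<in> insert {} {C \<in> P. C \<subseteq> Q `` {x}}"
    define P' where "P' = insert (insert x C) (P - {C})"
    have xP: "x \<notin> \<Union>P" and e: "{} \<notin> P" using P x by (auto simp: fine_partitions_def partition_on_def)
    then have xC: "x \<notin> C" using C by auto
    have the: "(THE D. D \<in> P' \<and> x \<in> D) = insert x C"
      unfolding P'_def by (rule the_equality) (use xP in auto)
    have DC: "insert x C - {x} = C" using xC by auto
    have "insert x C \<notin> P" using xP by auto
    then have "P' - {insert x C} = P - {C}" unfolding P'_def by auto
    then have "(P' - {insert x C}) \<union> ({C} - {{}}) = P" using C e by auto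
    then show "(let D = THE D. D \<in> insert (insert x C) (P - {C}) \<and> x \<in> D in
        ((insert (insert x C) (P - {C}) - {D}) \<union> ({D - {x}} - {{}}), D - {x})) = (P, C)"
      unfolding P'_def[symmetric] the Let_def DC by simp
  qed
next
  case 2
  show ?case
  proof
    fix P assume "P \<in> fine_partitions (insert x A) Q"
    then have P: "partition_on (insert x A) P" by (simp add: fine_partitions_def)
    then obtain D where D: "D \<in> P" "x \<in> D" by (auto simp: partition_on_def)
    have uniq: "E = D" if "E \<in> P" "x \<in> E" for E
      using disjointD[OF partition_onD2[OF P] that(1) D(1)] that(2) D(2) by blast
    have the: "(THE D. D \<in> P \<and> x \<in> D) = D" by (rule the_equality) (use D uniq in blast)+
    \<comment> \<open>The forward map deletes \<open>D - {x}\<close>; if this were already a block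
      of \<open>P\<close>, the round trip would lose it.\<close>
    have "D - {x} \<notin> P"
    proof
      assume a: "D - {x} \<in> P"
      have "(D - {x}) \<inter> D = {}"
        by (rule disjointD[OF partition_onD2[OF P] a D(1)]) (use D in auto)
      then have "D - {x} = {}" by auto
      then show False using a partition_onD3[OF P] by metis
    qed
    moreover have "insert x (D - {x}) = D" using D by auto
    ultimately show "(\<lambda>(P, C). insert (insert x C) (P - {C})) (let D = THE D. D \<in> P \<and> x \<in> D in
        ((P - {D}) \<union> ({D - {x}} - {{}}), D - {x})) = P"
      unfolding the Let_def using D(1) by auto
  qed
next
  case 3
  show ?case
  proof clarify
    fix P C assume P: "P \<in> fine_partitions A Q" and C: "C \<in> insert {} {C \<in> P. C \<subseteq> Q `` {x}}"
    have disj: "disjoint P" and U: "\<Union>P = A" and e: "{} \<notin> P" and BQ: "\<And>B. B \<in> P \<Longrightarrow> B \<times> B \<subseteq> Q"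
      using P by (auto simp: fine_partitions_def partition_on_def)
    have "partition_on (insert x A) (insert (insert x C) (P - {C}))"
    proof (rule partition_onI)
      show "\<Union>(insert (insert x C) (P - {C})) = insert x A" using C U by auto
      show "{} \<notin> insert (insert x C) (P - {C})" using e by auto
      have 1: "disjnt (insert x C) B" if "B \<in> P - {C}" for B
        using that C disj U x by (auto simp: disjoint_def disjnt_def)
      have "disjoint (P - {C})" using disj by (rule pairwise_subset) auto
      then have "disjoint (insert (insert x C) (P - {C}))"
        unfolding pairwise_insert using 1 disjnt_sym by blast
      then show "disjnt p q" if "p \<in> insert (insert x C) (P - {C})"
        "q \<in> insert (insert x C) (P - {C})" "p \<noteq> q" for p q
        using that by (rule pairwiseD)
    qed
    moreover have "insert x C \<times> insert x C \<subseteq> Q"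
    proof clarify
      fix a b assume ab: "a \<in> insert x C" "b \<in> insert x C"
      have "(x, c) \<in> Q" if "c \<in> insert x C" for c using that C Q(3) by auto
      then have "(x, a) \<in> Q" "(x, b) \<in> Q" using ab by blast+
      then show "(a, b) \<in> Q" using Q(1,2) by (meson symD transD)
    qed
    ultimately show "insert (insert x C) (P - {C}) \<in> fine_partitions (insert x A) Q"
      using BQ by (auto simp: fine_partitions_def)
  qed
next
  case 4
  show ?case
  proof (rule image_subsetI)
    fix P assume P: "P \<in> fine_partitions (insert x A) Q"
    have disj: "disjoint P" and U: "\<Union>P = insert x A" and e: "{} \<notin> P" and BQ: "\<And>B. B \<in> P \<Longrightarrow> B \<times> B \<subseteq> Q"
      using P by (auto simp: fine_partitions_def partition_on_def)
    obtain D where D: "D \<in> P" "x \<in> D" using U by auto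
    have uniq: "E = D" if "E \<in> P" "x \<in> E" for E
      using disjointD[OF disj that(1) D(1)] that(2) D(2) by blast
    have the: "(THE D. D \<in> P \<and> x \<in> D) = D" by (rule the_equality) (use D uniq in blast)+
    have "partition_on A ((P - {D}) \<union> ({D - {x}} - {{}}))"
    proof (rule partition_onI)
      show "\<Union>((P - {D}) \<union> ({D - {x}} - {{}})) = A"
      proof -
        have "\<Union>((P - {D}) \<union> ({D - {x}} - {{}})) = \<Union>(P - {D}) \<union> (D - {x})" by auto
        also have "\<dots> = (\<Union>P) - {x}" using uniq D by blast
        finally show ?thesis using U x by auto
      qed
      show "{} \<notin> (P - {D}) \<union> ({D - {x}} - {{}})" using e by auto
      have 1: "disjnt (D - {x}) B" if "B \<in> P - {D}" for B
        using that D disj by (auto simp: disjoint_def disjnt_def)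
      have "disjoint (P - {D})" using disj by (rule pairwise_subset) auto
      then have "disjoint (insert (D - {x}) (P - {D}))"
        unfolding pairwise_insert using 1 disjnt_sym by blast
      then have "disjoint ((P - {D}) \<union> ({D - {x}} - {{}}))" by (rule pairwise_subset) auto
      then show "disjnt p q" if "p \<in> (P - {D}) \<union> ({D - {x}} - {{}})"
        "q \<in> (P - {D}) \<union> ({D - {x}} - {{}})" "p \<noteq> q" for p q
        using that by (rule pairwiseD)
    qed
    moreover have "\<forall>B \<in> (P - {D}) \<union> ({D - {x}} - {{}}). B \<times> B \<subseteq> Q"
      using BQ D by auto
    moreover have "D - {x} \<subseteq> Q `` {x}" using BQ[OF D(1)] D(2) by auto
    ultimately show "(let D = THE D. D \<in> P \<and> x \<in> D in ((P - {D}) \<union> ({D - {x}} - {{}}), D - {x}))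
        \<in> (SIGMA P:fine_partitions A Q. insert {} {C \<in> P. C \<subseteq> Q `` {x}})"
      unfolding the Let_def by (auto simp: fine_partitions_def)
  qed
qed

text \<open>Induction on \<open>A\<close>. A new point \<open>x\<close> either forms a singleton, of
  weight 1, or joins a block \<open>C\<close> inside its class, which multiplies the weight by
  \<open>card C * z\<close>. The sizes of these blocks add up to the number \<open>k\<close> of old
  points in the class, so the total factor is \<open>1 + k * z\<close>.\<close>

lemma sum_fine_partitions:
  assumes U: "finite U" and Q: "equiv U Q" and A: "A \<subseteq> U"
  shows "(\<Sum>P\<in>fine_partitions A Q. \<Prod>B\<in>P. block_weight z B) =
    (\<Prod>C\<in>U // Q. \<Prod>i<card (C \<inter> A). 1 + of_nat i * z)"
  using finite_subset[OF A U] A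
proof (induction A rule: finite_induct)
  case empty
  have "fine_partitions {} Q = {{}}" by (auto simp: fine_partitions_def partition_on_empty)
  then show ?case by simp
next
  case (insert x A)
  have xU: "x \<in> U" and AU: "A \<subseteq> U" using insert.prems by auto
  have Q': "sym Q" "trans Q" "(x, x) \<in> Q"
    using Q xU by (auto simp: equiv_def refl_on_def)
  let ?k = "card (Q `` {x} \<inter> A)"
  let ?w = "\<lambda>P. \<Prod>B\<in>P. block_weight z B"
  have finP: "finite P" and finB: "\<And>B. B \<in> P \<Longrightarrow> finite B" if "P \<in> fine_partitions A Q" for P
  proof -
    have "\<Union>P = A" using that by (auto simp: fine_partitions_def partition_on_def)
    then show "finite P" "\<And>B. B \<in> P \<Longrightarrow> finite B" using insert(1)
      by (auto simp: finite_UnionD dest: finite_subset[rotated])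
  qed
  have inner: "(\<Sum>C\<in>insert {} {C \<in> P. C \<subseteq> Q `` {x}}. ?w (insert (insert x C) (P - {C}))) =
      ?w P * (1 + of_nat ?k * z)" if P: "P \<in> fine_partitions A Q" for P
  proof -
    have disj: "disjoint P" and UP: "\<Union>P = A" and e: "{} \<notin> P" and BQ: "\<And>B. B \<in> P \<Longrightarrow> B \<times> B \<subseteq> Q"
      using P by (auto simp: fine_partitions_def partition_on_def)
    have xP: "insert x C \<notin> P" for C using UP insert.hyps(2) by auto
    have fP: "finite P" using finP[OF P] .
    have 0: "?w (insert {x} P) = ?w P"
    proof -
      have "?w (insert {x} P) = block_weight z {x} * ?w P"
        using fP xP by (rule prod.insert)
      then show ?thesis by (simp add: block_weight_def)
    qed
    have 1: "?w (insert (insert x C) (P - {C})) = ?w P * (of_nat (card C) * z)" if C: "C \<in> P" for C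
    proof -
      have fC: "finite C" "C \<noteq> {}" "x \<notin> C" using finB[OF P C] e C UP insert.hyps(2) by auto
      then obtain k where k: "card C = Suc k" by (metis card_gt_0_iff gr0_implies_Suc)
      have "?w (insert (insert x C) (P - {C})) = block_weight z (insert x C) * ?w (P - {C})"
        using fP xP by (subst prod.insert) auto
      also have "block_weight z (insert x C) = block_weight z C * (of_nat (card C) * z)"
        using fC k by (simp add: block_weight_def)
      also have "\<dots> * ?w (P - {C}) = (block_weight z C * ?w (P - {C})) * (of_nat (card C) * z)" by simp
      also have "block_weight z C * ?w (P - {C}) = ?w P" using prod.remove[OF fP C] by metis
      finally show ?thesis .
    qed
    have "(\<Sum>C\<in>insert {} {C \<in> P. C \<subseteq> Q `` {x}}. ?w (insert (insert x C) (P - {C}))) =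
        ?w P + (\<Sum>C\<in>{C \<in> P. C \<subseteq> Q `` {x}}. ?w P * (of_nat (card C) * z))"
      using fP e by (subst sum.insert) (auto simp: 0 1 intro!: sum.cong)
    also have "(\<Sum>C\<in>{C \<in> P. C \<subseteq> Q `` {x}}. ?w P * (of_nat (card C) * z)) =
        ?w P * (of_nat (\<Sum>C\<in>{C \<in> P. C \<subseteq> Q `` {x}}. card C) * z)"
      by (simp add: sum_distrib_left sum_distrib_right)
    also have "(\<Sum>C\<in>{C \<in> P. C \<subseteq> Q `` {x}}. card C) = card (\<Union>{C \<in> P. C \<subseteq> Q `` {x}})"
      using disj finB[OF P] by (subst card_Union_disjoint) (auto simp: pairwise_def)
    \<comment> \<open>Each block lies in a single class of \<open>Q\<close>, so the blocks inside
      the class of \<open>x\<close> fill up its part of \<open>A\<close>.\<close>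
    also have "\<Union>{C \<in> P. C \<subseteq> Q `` {x}} = Q `` {x} \<inter> A"
    proof (intro equalityI subsetI)
      fix y assume y: "y \<in> Q `` {x} \<inter> A"
      then obtain C where C: "C \<in> P" "y \<in> C" using UP by auto
      have "C \<subseteq> Q `` {x}"
        using BQ[OF C(1)] C(2) y Q'(2) by (auto dest: transD)
      then show "y \<in> \<Union>{C \<in> P. C \<subseteq> Q `` {x}}" using C by auto
    qed (use UP in auto)
    finally show ?thesis by (simp add: algebra_simps)
  qed
  have "(\<Sum>P\<in>fine_partitions (insert x A) Q. ?w P) =
     (\<Sum>(P, C)\<in>(SIGMA P:fine_partitions A Q. insert {} {C \<in> P. C \<subseteq> Q `` {x}}). ?w (insert (insert x C) (P - {C})))"
    by (subst sum.reindex_bij_betw[OF fine_partitions_insert[OF Q' insert.hyps(2)], symmetric])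
       (simp add: case_prod_unfold)
  also have "\<dots> = (\<Sum>P\<in>fine_partitions A Q. \<Sum>C\<in>insert {} {C \<in> P. C \<subseteq> Q `` {x}}. ?w (insert (insert x C) (P - {C})))"
    using finite_fine_partitions[OF insert.hyps(1)] finP by (subst sum.Sigma) auto
  also have "\<dots> = (\<Sum>P\<in>fine_partitions A Q. ?w P) * (1 + of_nat ?k * z)"
    by (simp only: inner sum_distrib_right cong: sum.cong)
  also have "\<dots> = (\<Prod>C\<in>U // Q. \<Prod>i<card (C \<inter> A). 1 + of_nat i * z) * (1 + of_nat ?k * z)"
    using insert.IH AU by simp
  \<comment> \<open>Only the class of \<open>x\<close> gains a point, and its new factor is the one
    with index \<open>i = ?k\<close>.\<close>
  also have "\<dots> = (\<Prod>C\<in>U // Q. \<Prod>i<card (C \<inter> insert x A). 1 + of_nat i * z)"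
  proof -
    have fin: "finite (U // Q)" using U Q by (simp add: finite_quotient equiv_type)
    have C0: "Q `` {x} \<in> U // Q" using xU by (rule quotientI)
    have x0: "x \<in> Q `` {x}" using Q' by auto
    have "x \<notin> C" if "C \<in> U // Q - {Q `` {x}}" for C
      using quotient_disj[OF Q, of C "Q `` {x}"] that C0 x0 by auto
    then have "(\<Prod>C\<in>U // Q - {Q `` {x}}. \<Prod>i<card (C \<inter> insert x A). 1 + of_nat i * z) =
       (\<Prod>C\<in>U // Q - {Q `` {x}}. \<Prod>i<card (C \<inter> A). 1 + of_nat i * z)"
      by (intro prod.cong) auto
    moreover have "card (Q `` {x} \<inter> insert x A) = Suc ?k"
      using insert.hyps x0 by simp
    ultimately show ?thesis
      by (simp add: prod.remove[OF fin C0] mult_ac)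
  qed
  finally show ?case .
qed

section \<open>Supercompositions as equivalence relations\<close>

text \<open>
  The points \<open>1, \<dots>, n\<close> are the elements of \<open>[n]\<close>; the point \<open>n + 1 + i\<close> stands for the fermionic block
  with list index \<open>i\<close> and replaces the element 0 in that block.
\<close>

definition points :: "nat \<Rightarrow> nat \<Rightarrow> nat set" where
  "points n m = {1..n + m}"

definition blk :: "nat \<Rightarrow> nat \<Rightarrow> nat set list \<Rightarrow> nat \<Rightarrow> nat set" where
  "blk n m K i = (if i < m then insert (n + 1 + i) (K ! i - {0}) else K ! i)"

definition parts :: "nat \<Rightarrow> nat \<Rightarrow> nat set list \<Rightarrow> nat set set" where
  "parts n m K = blk n m K ` {..<length K}"

definition rel :: "nat \<Rightarrow> nat \<Rightarrow> nat set list \<Rightarrow> nat rel" where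
  "rel n m K = {(x, y). \<exists>B\<in>parts n m K. x \<in> B \<and> y \<in> B}"

text \<open>For \<open>m \<le> n + 1\<close>, this condition singles out the relations of
  supercompositions among the equivalence relations on \<open>points n m\<close>; see
  \<open>separates_labels_rel\<close> and \<open>rel_comp_of\<close>.\<close>

definition separates_labels :: "nat \<Rightarrow> nat \<Rightarrow> nat rel \<Rightarrow> bool" where
  "separates_labels n m R \<longleftrightarrow> (\<forall>i<m. \<forall>j<m. (n + 1 + i, n + 1 + j) \<in> R \<longrightarrow> i = j)"

lemma finite_points [simp]: "finite (points n m)"
  by (simp add: points_def)

section \<open>The labelled blocks of a supercomposition\<close>

context
  fixes n m :: nat and K :: "nat set list"
  assumes K: "K \<in> supercompositions n m"
begin

lemma supercomp_length: "m \<le> length K"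
  using K by (simp add: supercompositions_def)

lemma supercomp_block: "i < length K \<Longrightarrow> K ! i \<noteq> {} \<and> K ! i \<subseteq> {0..n}"
proof -
  assume "i < length K"
  moreover have "\<forall>B\<in>set K. B \<noteq> {} \<and> B \<subseteq> {0..n}" using K by (simp add: supercompositions_def)
  ultimately show ?thesis using nth_mem by blast
qed

lemma supercomp_zero: "i < length K \<Longrightarrow> 0 \<in> K ! i \<longleftrightarrow> i < m"
  using K by (simp add: supercompositions_def)

lemma supercomp_disjoint:
  "\<lbrakk>i < length K; j < length K; x \<in> K ! i; x \<in> K ! j; x \<noteq> 0\<rbrakk> \<Longrightarrow> i = j"
proof -
  assume *: "i < length K" "j < length K" "x \<in> K ! i" "x \<in> K ! j" "x \<noteq> 0"
  have "\<forall>i<length K. \<forall>j<length K. i \<noteq> j \<longrightarrow> K ! i \<inter> K ! j \<subseteq> {0}"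
    using K by (simp add: supercompositions_def)
  then show ?thesis using * by blast
qed

lemma supercomp_cover:
  assumes "x \<in> {1..n}"
  obtains i where "i < length K" "x \<in> K ! i"
proof -
  have "(\<Union>B\<in>set K. B - {0}) = {1..n}" using K by (simp add: supercompositions_def)
  then obtain B where "B \<in> set K" "x \<in> B" using assms by blast
  then show ?thesis using that by (metis in_set_conv_nth)
qed

lemma blk_letter: "\<lbrakk>i < length K; x \<in> {1..n}\<rbrakk> \<Longrightarrow> x \<in> blk n m K i \<longleftrightarrow> x \<in> K ! i"
  by (auto simp: blk_def)

lemma blk_label: "\<lbrakk>i < length K; j < m\<rbrakk> \<Longrightarrow> n + 1 + j \<in> blk n m K i \<longleftrightarrow> i = j"
proof -
  assume i: "i < length K" "j < m"
  have "n + 1 + j \<notin> K ! i" using supercomp_block[OF i(1)] by auto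
  then show ?thesis using i(2) by (auto simp: blk_def)
qed

lemma blk_subset: "i < length K \<Longrightarrow> blk n m K i \<subseteq> points n m"
proof
  fix x assume i: "i < length K" and x: "x \<in> blk n m K i"
  have "x \<noteq> 0"
  proof
    assume "x = 0"
    then show False using supercomp_zero[OF i] x by (cases "i < m") (auto simp: blk_def)
  qed
  moreover have "x \<in> {0..n} \<or> i < m \<and> x = n + 1 + i"
    using supercomp_block[OF i] x by (cases "i < m") (auto simp: blk_def)
  ultimately show "x \<in> points n m" by (auto simp: points_def)
qed

lemma points_cases:
  assumes "x \<in> points n m"
  obtains "x \<in> {1..n}" | j where "j < m" "x = n + 1 + j"
  using assms that(1) that(2)[of "x - n - 1"] by (cases "x \<le> n") (auto simp: points_def)

lemma blk_disjoint:
  assumes "i < length K" "j < length K" "x \<in> blk n m K i" "x \<in> blk n m K j"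
  shows "i = j"
proof -
  have "x \<in> points n m" using blk_subset assms by blast
  then show ?thesis
  proof (cases rule: points_cases)
    case 1
    then have "x \<in> K ! i" "x \<in> K ! j" "x \<noteq> 0"
      using assms(3,4) blk_letter[OF assms(1)] blk_letter[OF assms(2)] by simp_all
    then show ?thesis using supercomp_disjoint[OF assms(1,2)] by blast
  next
    case (2 l)
    then show ?thesis using assms blk_label[of i l] blk_label[of j l] by simp
  qed
qed

lemma blk_nonempty: "i < length K \<Longrightarrow> blk n m K i \<noteq> {}"
  using supercomp_block[of i] by (auto simp: blk_def)

text \<open>Several fermionic blocks may equal \<open>{0}\<close>; their labels keep them apart as
  sets. This is what allows a product over the list \<open>K\<close> to become one over the set
  \<open>parts n m K\<close>.\<close>

lemma inj_on_blk: "inj_on (blk n m K) {..<length K}"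
proof (rule inj_onI)
  fix i j assume ij: "i \<in> {..<length K}" "j \<in> {..<length K}" "blk n m K i = blk n m K j"
  then obtain x where "x \<in> blk n m K i" "x \<in> blk n m K j" using blk_nonempty by blast
  then show "i = j" using ij(1,2) blk_disjoint[of i j x] by simp
qed

lemma partition_on_parts: "partition_on (points n m) (parts n m K)"
proof (rule partition_onI)
  show "\<Union>(parts n m K) = points n m"
  proof (intro equalityI subsetI)
    fix x assume "x \<in> points n m"
    then show "x \<in> \<Union>(parts n m K)"
    proof (cases rule: points_cases)
      case 1
      then obtain i where "i < length K" "x \<in> K ! i" by (rule supercomp_cover)
      then have "x \<in> blk n m K i" using blk_letter 1 by blast
      then show ?thesis using \<open>i < length K\<close> by (auto simp: parts_def)
    next
      case (2 j)
      then have "j < length K" "x \<in> blk n m K j" using supercomp_length by (auto simp: blk_def)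
      then show ?thesis by (auto simp: parts_def)
    qed
  qed (use blk_subset in \<open>auto simp: parts_def\<close>)
  show "{} \<notin> parts n m K"
  proof
    assume "{} \<in> parts n m K"
    then obtain i where "i < length K" "blk n m K i = {}" by (auto simp: parts_def)
    then show False using blk_nonempty by simp
  qed
  fix p q assume "p \<in> parts n m K" "q \<in> parts n m K" "p \<noteq> q"
  then obtain i j where ij: "i < length K" "j < length K" "i \<noteq> j" "p = blk n m K i" "q = blk n m K j"
    by (auto simp: parts_def)
  then show "disjnt p q" using blk_disjoint[OF ij(1,2)] by (auto simp: disjnt_iff)
qed

lemma equiv_rel: "equiv (points n m) (rel n m K)"
  unfolding rel_def by (rule equiv_partition_on[OF partition_on_parts])

lemma quotient_rel: "points n m // rel n m K = parts n m K"
  unfolding rel_def by (rule partition_on_eq_quotient[OF partition_on_parts])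

lemma rel_blk: "\<lbrakk>i < length K; x \<in> blk n m K i\<rbrakk> \<Longrightarrow> (x, y) \<in> rel n m K \<longleftrightarrow> y \<in> blk n m K i"
proof
  assume i: "i < length K" "x \<in> blk n m K i"
  show "y \<in> blk n m K i" if xy: "(x, y) \<in> rel n m K"
  proof -
    obtain j where j: "j < length K" "x \<in> blk n m K j" "y \<in> blk n m K j"
      using xy by (auto simp: rel_def parts_def)
    then show ?thesis using blk_disjoint[OF i(1) j(1) i(2) j(2)] by simp
  qed
  show "(x, y) \<in> rel n m K" if "y \<in> blk n m K i"
    using i that by (auto simp: rel_def parts_def)
qed

lemma separates_labels_rel: "separates_labels n m (rel n m K)"
  unfolding separates_labels_def
proof (intro allI impI)
  fix i j assume "i < m" "j < m" "(n + 1 + i, n + 1 + j) \<in> rel n m K"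
  moreover have "i < length K" using supercomp_length \<open>i < m\<close> by simp
  moreover have "n + 1 + i \<in> blk n m K i" using \<open>i < m\<close> by (simp add: blk_def)
  ultimately show "i = j" using rel_blk[of i "n + 1 + i"] blk_label[of i j] by blast
qed

text \<open>In a fermionic block the label takes the place of 0. Hence signs, factorials and
  weights, which depend on block sizes counted with 0, can be read off from
  \<open>parts\<close>.\<close>

lemma card_blk:
  assumes "i < length K"
  shows "card (blk n m K i) = card (K ! i)"
proof (cases "i < m")
  case True
  have fin: "finite (K ! i)" using supercomp_block[OF assms] finite_subset by blast
  have z: "0 \<in> K ! i" using supercomp_zero[OF assms] True by simp
  have "n + 1 + i \<notin> K ! i" using supercomp_block[OF assms] by auto
  then show ?thesis using True fin card.remove[OF fin z] by (simp add: blk_def)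
qed (simp add: blk_def)

lemma prod_list_parts:
  fixes f :: "nat \<Rightarrow> 'b::comm_monoid_mult"
  shows "(\<Prod>B\<leftarrow>K. f (card B)) = (\<Prod>B\<in>parts n m K. f (card B))"
proof -
  have "(\<Prod>B\<leftarrow>K. f (card B)) = (\<Prod>i<length K. f (card (K ! i)))"
    by (simp add: prod.list_conv_set_nth atLeast0LessThan)
  also have "\<dots> = (\<Prod>i<length K. f (card (blk n m K i)))"
    using card_blk by simp
  also have "\<dots> = (\<Prod>B\<in>parts n m K. f (card B))"
    unfolding parts_def by (simp add: prod.reindex[OF inj_on_blk])
  finally show ?thesis .
qed

lemma drop_block:
  assumes "B \<in> set (drop m K)"
  obtains i where "m \<le> i" "i < length K" "B = K ! i" "blk n m K i = B"
proof -
  obtain l where "l < length (drop m K)" "B = drop m K ! l"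
    using assms by (metis in_set_conv_nth)
  then show ?thesis using that[of "m + l"] by (auto simp: blk_def)
qed

lemma nth_drop_mem: "\<lbrakk>m \<le> i; i < length K\<rbrakk> \<Longrightarrow> K ! i \<in> set (drop m K)"
proof -
  assume i: "m \<le> i" "i < length K"
  then have "drop m K ! (i - m) = K ! i" "i - m < length (drop m K)" by auto
  then show ?thesis using nth_mem by metis
qed

end

text \<open>Inclusion of the relations means that every labelled block of \<open>K\<close> lies in
  one of \<open>L\<close>. The labels force the fermionic block with index \<open>i\<close> into the
  one of \<open>L\<close> with the same index, while nonfermionic blocks may go anywhere, as in
  \<open>refines\<close>.\<close>

lemma refines_iff_rel_subset:
  assumes K: "K \<in> supercompositions n m" and L: "L \<in> supercompositions n m"
  shows "refines m K L \<longleftrightarrow> rel n m K \<subseteq> rel n m L"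
proof
  assume KL: "refines m K L"
  have "\<exists>j<length L. blk n m K i \<subseteq> blk n m L j" if i: "i < length K" for i
  proof (cases "i < m")
    case True
    then have "K ! i \<subseteq> L ! i" using refines_fermionic[OF KL] by blast
    then show ?thesis using True supercomp_length[OF L] by (intro exI[of _ i]) (auto simp: blk_def)
  next
    case False
    then have bK: "blk n m K i = K ! i" by (simp add: blk_def)
    obtain x where x: "x \<in> K ! i" using supercomp_block[OF K i] by blast
    have x0: "0 \<notin> K ! i" using supercomp_zero[OF K i] False by simp
    have "x \<noteq> 0" using x x0 by metis
    then have xn: "x \<in> {1..n}" using x supercomp_block[OF K i] by (auto simp: Suc_le_eq)
    obtain j where j: "j < length L" "x \<in> L ! j" using supercomp_cover[OF L xn] .
    \<comment> \<open>The nonzero point \<open>x\<close> lies in no other block of \<open>K\<close>,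
      so a union of blocks that contains \<open>x\<close> must use all of
      \<open>K ! i\<close>.\<close>
    have sub: "K ! i \<subseteq> \<Union>\<B>" if sB: "\<B> \<subseteq> set (drop m K)" "x \<in> \<Union>\<B>" for \<B>
    proof -
      obtain B where B: "B \<in> \<B>" "x \<in> B" using sB(2) by blast
      then have "B \<in> set (drop m K)" using sB(1) by blast
      then obtain l where "m \<le> l" "l < length K" "B = K ! l" "blk n m K l = B" by (rule drop_block[OF K])
      then have "l = i" using supercomp_disjoint[OF K _ i _ x \<open>x \<noteq> 0\<close>] B(2) by blast
      then show ?thesis using \<open>B = K ! l\<close> B(1) by blast
    qed
    have "K ! i \<subseteq> L ! j"
    proof (cases "j < m")
      case True
      obtain \<B> where B: "\<B> \<subseteq> set (drop m K)" "L ! j = K ! j \<union> \<Union>\<B>"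
        using refines_fermionic[OF KL True] by blast
      have "x \<notin> K ! j"
      proof
        assume "x \<in> K ! j"
        moreover have "j < length K" using True supercomp_length[OF K] by simp
        ultimately have "i = j" using supercomp_disjoint[OF K i _ x _ \<open>x \<noteq> 0\<close>] by blast
        then show False using True \<open>\<not> i < m\<close> by simp
      qed
      then show ?thesis using sub[OF B(1)] B(2) j(2) by auto
    next
      case False
      then have "L ! j \<in> set (drop m L)" using nth_drop_mem[OF L] j(1) by simp
      then obtain \<B> where B: "\<B> \<subseteq> set (drop m K)" "L ! j = \<Union>\<B>"
        using refines_nonfermionic[OF KL] by blast
      then show ?thesis using sub[OF B(1)] j(2) by auto
    qed
    then have "blk n m K i \<subseteq> blk n m L j" using bK x0 by (auto simp: blk_def)
    then show ?thesis using j(1) by blast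
  qed
  note blk_sub = this
  show "rel n m K \<subseteq> rel n m L"
  proof (rule subrelI)
    fix x y assume "(x, y) \<in> rel n m K"
    then obtain i where i: "i < length K" "x \<in> blk n m K i" "y \<in> blk n m K i"
      by (auto simp: rel_def parts_def)
    obtain j where "j < length L" "blk n m K i \<subseteq> blk n m L j" using blk_sub[OF i(1)] by blast
    then show "(x, y) \<in> rel n m L" using i(2,3) by (auto simp: rel_def parts_def)
  qed
next
  assume sub: "rel n m K \<subseteq> rel n m L"
  have closed: "blk n m K i \<subseteq> blk n m L j"
    if "i < length K" "j < length L" "x \<in> blk n m K i" "x \<in> blk n m L j" for i j x
    using sub rel_blk[OF K that(1,3)] rel_blk[OF L that(2,4)] by blast
  show "refines m K L"
    unfolding refines_def
  proof (intro conjI allI impI ballI)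
    fix i assume i: "i < m"
    then have iK: "i < length K" and iL: "i < length L"
      using supercomp_length[OF K] supercomp_length[OF L] by auto
    have ii: "blk n m K i \<subseteq> blk n m L i"
      using closed[OF iK iL, of "n + 1 + i"] i by (simp add: blk_def)
    \<comment> \<open>The witness is the largest candidate: all nonfermionic blocks of
      \<open>K\<close> inside the given block of \<open>L\<close>. The nonfermionic case below makes
      the same choice.\<close>
    have "L ! i = K ! i \<union> \<Union>{B \<in> set (drop m K). B \<subseteq> L ! i}" (is "_ = ?R")
    proof (intro equalityI subsetI)
      fix x assume x: "x \<in> L ! i"
      show "x \<in> ?R"
      proof (cases "x = 0")
        case True
        then show ?thesis using supercomp_zero[OF K iK] i by simp
      next
        case False
        then have xn: "x \<in> {1..n}" using x supercomp_block[OF L iL] by (auto simp: Suc_le_eq)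
        obtain j where j: "j < length K" "x \<in> K ! j" using supercomp_cover[OF K xn] .
        have ji: "blk n m K j \<subseteq> blk n m L i"
          using closed[OF j(1) iL, of x] xn j x blk_letter[OF K j(1)] blk_letter[OF L iL] by blast
        show ?thesis
        proof (cases "j < m")
          case True
          then have "n + 1 + j \<in> blk n m K j" by (simp add: blk_def)
          \<comment> \<open>A fermionic block of \<open>K\<close> brings its label along, and block
            \<open>i\<close> of \<open>L\<close> holds only its own label.\<close>
          then have "i = j" using ji blk_label[OF L iL True] by blast
          then show ?thesis using j by simp
        next
          case False
          have "K ! j \<subseteq> L ! i"
          proof
            fix y assume y: "y \<in> K ! j"
            then have "y \<in> {1..n}"
              using supercomp_block[OF K j(1)] supercomp_zero[OF K j(1)] False
              by (metis atLeastAtMost_iff less_one not_less subsetD)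
            then show "y \<in> L ! i"
              using ji y blk_letter[OF K j(1)] blk_letter[OF L iL] by blast
          qed
          then show ?thesis using nth_drop_mem[OF K _ j(1)] False j by auto
        qed
      qed
    next
      fix x assume "x \<in> ?R"
      then consider "x \<in> K ! i" | "x \<in> L ! i" by blast
      then show "x \<in> L ! i"
      proof cases
        case 1
        show ?thesis
        proof (cases "x = 0")
          case True
          then show ?thesis using supercomp_zero[OF L iL] i by simp
        next
          case False
          then have "x \<in> {1..n}" using 1 supercomp_block[OF K iK] by (auto simp: Suc_le_eq)
          then show ?thesis using ii 1 blk_letter[OF K iK] blk_letter[OF L iL] by blast
        qed
      qed
    qed
    then show "\<exists>\<B>\<subseteq>set (drop m K). L ! i = K ! i \<union> \<Union>\<B>"
      by (intro exI[of _ "{B \<in> set (drop m K). B \<subseteq> L ! i}"] conjI Collect_restrict)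
  next
    fix C assume "C \<in> set (drop m L)"
    then obtain j where j: "m \<le> j" "j < length L" "C = L ! j" "blk n m L j = C"
      by (rule drop_block[OF L])
    have "C \<subseteq> \<Union>{B \<in> set (drop m K). B \<subseteq> C}"
    proof
      fix x assume x: "x \<in> C"
      have "C \<subseteq> {1..n}"
        using supercomp_block[OF L j(2)] supercomp_zero[OF L j(2)] j(1,3)
        by (metis atLeastAtMost_iff less_one not_less subsetD subsetI)
      then have xn: "x \<in> {1..n}" using x by blast
      obtain l where l: "l < length K" "x \<in> K ! l" using supercomp_cover[OF K xn] .
      have lj: "blk n m K l \<subseteq> C"
        using closed[OF l(1) j(2), of x] x j(4) blk_letter[OF K l(1) xn] l(2) by blast
      have "\<not> l < m"
      proof
        assume "l < m"
        then have "n + 1 + l \<in> C" using lj by (auto simp: blk_def)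
        then show False using \<open>C \<subseteq> {1..n}\<close> by auto
      qed
      then have "K ! l \<in> set (drop m K)" "K ! l \<subseteq> C"
        using nth_drop_mem[OF K _ l(1)] lj by (auto simp: blk_def)
      then show "x \<in> \<Union>{B \<in> set (drop m K). B \<subseteq> C}" using l(2) by blast
    qed
    moreover have "\<Union>{B \<in> set (drop m K). B \<subseteq> C} \<subseteq> C" by blast
    ultimately have "C = \<Union>{B \<in> set (drop m K). B \<subseteq> C}" by (rule equalityI)
    then show "\<exists>\<B>\<subseteq>set (drop m K). C = \<Union>\<B>"
      by (intro exI[of _ "{B \<in> set (drop m K). B \<subseteq> C}"] conjI Collect_restrict)
  qed
qed

section \<open>Recovering a supercomposition from its relation\<close>

lemma rel_inject:
  assumes "K \<in> supercompositions n m" "L \<in> supercompositions n m" "rel n m K = rel n m L"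
  shows "K = L"
  using assms by (intro refines_antisym[of K n m L]) (simp_all add: refines_iff_rel_subset)

text \<open>The first \<open>m\<close> entries are the classes of the labels, with 0 in place of the
  label. Labels exceed \<open>n\<close>, so the filter keeps exactly the minima of the label-free
  classes; running through them in increasing order lists each such class once, sorted by
  minimum.\<close>

definition comp_of :: "nat \<Rightarrow> nat \<Rightarrow> nat rel \<Rightarrow> nat set list" where
  "comp_of n m R = map (\<lambda>i. insert 0 (R `` {n + 1 + i} \<inter> {1..n})) [0..<m] @
     map (\<lambda>j. R `` {j}) (filter (\<lambda>j. \<forall>k\<in>R `` {j}. j \<le> k \<and> k \<le> n) [1..<n + 1])"

text \<open>By \<open>sep\<close> a class holds at most one label. A class with a label becomes the
  fermionic block of that index; a class without one is represented by its minimum in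
  \<open>F\<close>. So no class is lost or repeated.\<close>

lemma
  assumes R: "equiv (points n m) R" and sep: "separates_labels n m R" and mn: "m \<le> n + 1"
  shows comp_of_supercomposition: "comp_of n m R \<in> supercompositions n m"
    and rel_comp_of: "rel n m (comp_of n m R) = R"
proof -
  let ?K = "comp_of n m R"
  define F where "F = filter (\<lambda>j. \<forall>k\<in>R `` {j}. j \<le> k \<and> k \<le> n) [1..<n + 1]"
  have sub: "R \<subseteq> points n m \<times> points n m" using R by (rule equiv_type)
  have refl: "(x, x) \<in> R" if "x \<in> points n m" for x
    using R that by (auto simp: equiv_def refl_on_def)
  have sym: "(y, x) \<in> R" if "(x, y) \<in> R" for x y
    using R that unfolding equiv_def by (blast dest: symD)
  have trans: "(x, z) \<in> R" if "(x, y) \<in> R" "(y, z) \<in> R" for x y z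
    using R that unfolding equiv_def by (blast dest: transD)
  have lenK: "length ?K = m + length F" by (simp add: comp_of_def F_def)
  have ferm: "?K ! i = insert 0 (R `` {n + 1 + i} \<inter> {1..n})" if "i < m" for i
    using that by (simp add: comp_of_def nth_append)
  have nonferm: "?K ! i = R `` {F ! (i - m)}" if "m \<le> i" "i < length ?K" for i
    using that lenK by (simp add: comp_of_def nth_append F_def)
  have mem_F: "j \<in> set F \<longleftrightarrow> j \<in> {1..n} \<and> (\<forall>k\<in>R `` {j}. j \<le> k \<and> k \<le> n)" for j
    by (auto simp: F_def)
  have F: "F ! l \<in> {1..n}" "\<And>k. (F ! l, k) \<in> R \<Longrightarrow> F ! l \<le> k \<and> k \<in> {1..n}" if "l < length F" for l
  proof -
    have "F ! l \<in> set F" using that by simp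
    then have *: "F ! l \<in> {1..n}" "\<forall>k\<in>R `` {F ! l}. F ! l \<le> k \<and> k \<le> n"
      unfolding mem_F by blast+
    then show "F ! l \<in> {1..n}" by blast
    show "F ! l \<le> k \<and> k \<in> {1..n}" if "(F ! l, k) \<in> R" for k
    proof -
      have "F ! l \<le> k" "k \<le> n" using *(2) that by blast+
      then show ?thesis using *(1) by simp
    qed
  qed
  have setF: "j \<in> set F" if "j \<in> {1..n}" "\<And>k. (j, k) \<in> R \<Longrightarrow> j \<le> k \<and> k \<le> n" for j
    using that by (auto simp: mem_F)
  have sortF: "sorted_wrt (<) F"
    unfolding F_def by (rule sorted_wrt_filter) (simp add: sorted_wrt_upt del: upt_Suc)
  then have distF: "distinct F" by (simp add: strict_sorted_iff)
  have no_label: "(n + 1 + i, n + 1 + j) \<in> R \<Longrightarrow> i = j" if "i < m" "j < m" for i j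
    using sep that by (auto simp: separates_labels_def)
  have point: "x \<in> {1..n} \<Longrightarrow> x \<in> points n m" for x by (auto simp: points_def)
  have cover: "\<exists>i<length ?K. if i < m then (n + 1 + i, x) \<in> R else (F ! (i - m), x) \<in> R"
    if x: "x \<in> points n m" for x
  proof (cases "\<exists>i<m. (n + 1 + i, x) \<in> R")
    case True
    then show ?thesis using lenK by force
  next
    case False
    \<comment> \<open>A class without labels is represented in \<open>F\<close> by its least
      element.\<close>
    define j where "j = (LEAST k. (x, k) \<in> R)"
    have j: "(x, j) \<in> R" "\<And>k. (x, k) \<in> R \<Longrightarrow> j \<le> k"
      unfolding j_def using refl[OF x] by (auto intro: LeastI Least_le)
    have le: "k \<in> {1..n}" if k: "(x, k) \<in> R" for k
    proof -
      have "k \<in> points n m" using sub k by auto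
      moreover have "k \<le> n"
      proof (rule ccontr)
        assume "\<not> k \<le> n"
        then have "k - n - 1 < m" "k = n + 1 + (k - n - 1)"
          using \<open>k \<in> points n m\<close> by (auto simp: points_def)
        then show False using False sym[OF k] by metis
      qed
      ultimately show ?thesis by (simp add: points_def)
    qed
    have "j \<in> set F"
      using j le trans[OF j(1)] by (intro setF) auto
    then obtain l where "l < length F" "F ! l = j" by (metis in_set_conv_nth)
    then show ?thesis using sym[OF j(1)] lenK by (intro exI[of _ "m + l"]) simp
  qed
  have blkK: "blk n m ?K i = (if i < m then R `` {n + 1 + i} else R `` {F ! (i - m)})"
    if i: "i < length ?K" for i
  proof (cases "i < m")
    case True
    \<comment> \<open>The class of a label consists of that label and points of
      \<open>{1..n}\<close>, since no second label can occur.\<close>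
    have "y = n + 1 + i \<or> y \<in> {1..n}" if "(n + 1 + i, y) \<in> R" for y
    proof (rule disjCI)
      assume "y \<notin> {1..n}"
      moreover have "y \<in> points n m" using sub that by auto
      ultimately have "y - n - 1 < m" "y = n + 1 + (y - n - 1)"
        by (auto simp: points_def)
      then show "y = n + 1 + i" using no_label[OF True] that by metis
    qed
    moreover have "(n + 1 + i, n + 1 + i) \<in> R" using True by (intro refl) (simp add: points_def)
    moreover have "0 \<notin> {1..n}" by simp
    ultimately have "insert (n + 1 + i) (insert 0 (R `` {n + 1 + i} \<inter> {1..n}) - {0}) = R `` {n + 1 + i}"
      unfolding Image_singleton by blast
    then show ?thesis using True ferm[OF True] by (simp add: blk_def)
  qed (use nonferm i in \<open>simp add: blk_def\<close>)
  have disj: "i = j" if ij: "i < length ?K" "j < length ?K" and x: "x \<in> ?K ! i" "x \<in> ?K ! j" "x \<noteq> 0" for i j x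
  proof -
    consider "i < m" "j < m" | "i < m" "m \<le> j" | "m \<le> i" "j < m" | "m \<le> i" "m \<le> j" by linarith
    then show ?thesis
    proof cases
      case 1
      then have "(n + 1 + i, x) \<in> R" "(n + 1 + j, x) \<in> R" using x ferm by auto
      then show ?thesis using no_label[OF 1] sym trans by blast
    next
      case 2
      then have "(n + 1 + i, x) \<in> R" "(F ! (j - m), x) \<in> R" using x ij ferm nonferm by auto
      \<comment> \<open>A class listed in \<open>F\<close> stays within \<open>{1..n}\<close>, so
        containing a label is a contradiction.\<close>
      then have "(F ! (j - m), n + 1 + i) \<in> R" using sym trans by blast
      then have "n + 1 + i \<in> {1..n}" using F(2)[of "j - m"] 2 ij lenK by auto
      then show ?thesis by simp
    next
      case 3
      then have "(n + 1 + j, x) \<in> R" "(F ! (i - m), x) \<in> R" using x ij ferm nonferm by auto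
      then have "(F ! (i - m), n + 1 + j) \<in> R" using sym trans by blast
      then have "n + 1 + j \<in> {1..n}" using F(2)[of "i - m"] 3 ij lenK by auto
      then show ?thesis by simp
    next
      case 4
      then have *: "(F ! (i - m), x) \<in> R" "(F ! (j - m), x) \<in> R" using x ij nonferm by auto
      have l: "i - m < length F" "j - m < length F" using 4 ij lenK by auto
      have "(F ! (i - m), F ! (j - m)) \<in> R" "(F ! (j - m), F ! (i - m)) \<in> R"
        using * sym trans by blast+
      then have "F ! (i - m) = F ! (j - m)" using F(2) l by (meson le_antisym)
      then have "i - m = j - m" using distF l nth_eq_iff_index_eq by blast
      then show ?thesis using 4 by simp
    qed
  qed
  have zero: "0 \<in> ?K ! i \<longleftrightarrow> i < m" if "i < length ?K" for i
  proof (cases "i < m")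
    case False
    then have "i - m < length F" "?K ! i = R `` {F ! (i - m)}" using nonferm that lenK by auto
    then have "0 \<notin> ?K ! i" using F(2)[of "i - m" 0] by auto
    then show ?thesis using False by simp
  qed (simp add: ferm)
  have bounds: "?K ! i \<noteq> {} \<and> ?K ! i \<subseteq> {0..n}" if "i < length ?K" for i
  proof (cases "i < m")
    case False
    then have "i - m < length F" "?K ! i = R `` {F ! (i - m)}" using nonferm that lenK by auto
    moreover have "(F ! (i - m), F ! (i - m)) \<in> R" using refl point F(1) calculation by blast
    moreover have "k \<in> {0..n}" if "(F ! (i - m), k) \<in> R" for k
      using F(2)[OF calculation(1) that] by simp
    ultimately show ?thesis by blast
  qed (auto simp: ferm)
  have union: "(\<Union>B\<in>set ?K. B - {0}) = {1..n}"
  proof (intro equalityI subsetI)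
    fix x assume "x \<in> (\<Union>B\<in>set ?K. B - {0})"
    then obtain i where "i < length ?K" "x \<in> ?K ! i" "x \<noteq> 0" by (auto simp: in_set_conv_nth)
    then have "x \<in> {0..n}" using bounds[of i] by blast
    then show "x \<in> {1..n}" using \<open>x \<noteq> 0\<close> by simp
  next
    fix x assume x: "x \<in> {1..n}"
    obtain i where i: "i < length ?K" "if i < m then (n + 1 + i, x) \<in> R else (F ! (i - m), x) \<in> R"
      using cover[OF point[OF x]] by blast
    then have "x \<in> ?K ! i" using x by (cases "i < m") (auto simp: ferm nonferm)
    moreover have "?K ! i \<in> set ?K" using i(1) by (rule nth_mem)
    moreover have "x \<noteq> 0" using x by simp
    ultimately show "x \<in> (\<Union>B\<in>set ?K. B - {0})" by blast
  qed
  have "sorted_wrt (\<lambda>A B. Min A < Min B) (drop m ?K)"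
  proof -
    have d: "drop m ?K = map (\<lambda>j. R `` {j}) F" by (simp add: comp_of_def F_def)
    have Min: "Min (R `` {j}) = j" if j: "j \<in> set F" for j
    proof -
      obtain l where l: "l < length F" "F ! l = j" using j by (metis in_set_conv_nth)
      have "finite (R `` {j})" using sub by (intro finite_subset[OF _ finite_points[of n m]]) auto
      then show ?thesis using F[OF l(1)] l(2) refl[OF point, of j] by (intro Min_eqI) auto
    qed
    have "sorted_wrt (\<lambda>i j. Min (R `` {i}) < Min (R `` {j})) F"
      using sortF by (rule sorted_wrt_mono_rel[rotated]) (simp add: Min)
    then show ?thesis by (simp add: d sorted_wrt_map)
  qed
  moreover have "\<forall>B\<in>set ?K. B \<noteq> {} \<and> B \<subseteq> {0..n}"
    using bounds by (metis in_set_conv_nth)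
  moreover have "\<forall>i<length ?K. \<forall>j<length ?K. i \<noteq> j \<longrightarrow> ?K ! i \<inter> ?K ! j \<subseteq> {0}"
    using disj by blast
  ultimately show "?K \<in> supercompositions n m"
    unfolding supercompositions_def using mn lenK union zero by auto
  show "rel n m ?K = R"
  proof (intro equalityI subrelI)
    fix x y assume "(x, y) \<in> rel n m ?K"
    then obtain i where "i < length ?K" "x \<in> blk n m ?K i" "y \<in> blk n m ?K i"
      by (auto simp: rel_def parts_def)
    moreover from \<open>i < length ?K\<close> obtain p where "blk n m ?K i = R `` {p}" using blkK by metis
    ultimately have "(p, x) \<in> R" "(p, y) \<in> R" by auto
    then show "(x, y) \<in> R" using sym trans by blast
  next
    fix x y assume xy: "(x, y) \<in> R"
    then obtain i where i: "i < length ?K" "if i < m then (n + 1 + i, x) \<in> R else (F ! (i - m), x) \<in> R"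
      using cover sub by blast
    then have "x \<in> blk n m ?K i \<and> y \<in> blk n m ?K i"
      using blkK[OF i(1)] trans[OF _ xy] by (cases "i < m") auto
    then show "(x, y) \<in> rel n m ?K" using i(1) by (auto simp: rel_def parts_def)
  qed
qed

text \<open>An equivalence relation inside \<open>Q\<close> inherits the separation of labels, so
  every partition finer than \<open>Q\<close> arises from a supercomposition through
  \<open>comp_of\<close>.\<close>

lemma bij_betw_parts:
  assumes Q: "separates_labels n m Q" and mn: "m \<le> n + 1"
  shows "bij_betw (parts n m) {K \<in> supercompositions n m. rel n m K \<subseteq> Q}
    (fine_partitions (points n m) Q)"
proof (rule bij_betwI')
  fix K L assume "K \<in> {K \<in> supercompositions n m. rel n m K \<subseteq> Q}"
    "L \<in> {K \<in> supercompositions n m. rel n m K \<subseteq> Q}"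
  then show "parts n m K = parts n m L \<longleftrightarrow> K = L"
    using rel_inject[of K n m L] by (auto simp: rel_def)
next
  fix K assume K: "K \<in> {K \<in> supercompositions n m. rel n m K \<subseteq> Q}"
  then have "\<forall>B\<in>parts n m K. B \<times> B \<subseteq> Q" by (auto simp: rel_def)
  then show "parts n m K \<in> fine_partitions (points n m) Q"
    using K partition_on_parts by (auto simp: fine_partitions_def)
next
  fix P assume P: "P \<in> fine_partitions (points n m) Q"
  define R where "R = {(x, y). \<exists>p\<in>P. x \<in> p \<and> y \<in> p}"
  have part: "partition_on (points n m) P" and RQ: "R \<subseteq> Q"
    using P by (auto simp: fine_partitions_def R_def)
  have "equiv (points n m) R" unfolding R_def by (rule equiv_partition_on[OF part])
  moreover have "separates_labels n m R" using Q RQ by (auto simp: separates_labels_def)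
  ultimately have K: "comp_of n m R \<in> supercompositions n m" "rel n m (comp_of n m R) = R"
    using mn by (rule comp_of_supercomposition, rule rel_comp_of)
  then have "parts n m (comp_of n m R) = points n m // R" using quotient_rel by metis
  also have "\<dots> = P" unfolding R_def by (rule partition_on_eq_quotient[OF part])
  finally show "\<exists>K\<in>{K \<in> supercompositions n m. rel n m K \<subseteq> Q}. P = parts n m K"
    using K RQ by (intro bexI[of _ "comp_of n m R"]) auto
qed

text \<open>The value at \<open>z = -1\<close> is the Moebius function from the least element to
  \<open>K\<close>, and the value at \<open>z = 1\<close> its absolute value; see
  \<open>mobius_least_comp\<close> and \<open>abs_mobius_least_comp\<close>.\<close>

definition comp_weight :: "rat \<Rightarrow> nat set list \<Rightarrow> rat" where
  "comp_weight z K = (\<Prod>B\<leftarrow>K. block_weight z B)"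

text \<open>This is \<open>sum_fine_partitions\<close> on the full ground set, carried over along
  \<open>bij_betw_parts\<close>.\<close>

lemma sum_comp_weight:
  assumes Q: "equiv (points n m) Q" "separates_labels n m Q" and mn: "m \<le> n + 1"
  shows "(\<Sum>K | K \<in> supercompositions n m \<and> rel n m K \<subseteq> Q. comp_weight z K) =
    (\<Prod>C\<in>points n m // Q. \<Prod>i<card C. 1 + of_nat i * z)"
proof -
  have "(\<Sum>K | K \<in> supercompositions n m \<and> rel n m K \<subseteq> Q. comp_weight z K) =
      (\<Sum>K | K \<in> supercompositions n m \<and> rel n m K \<subseteq> Q. \<Prod>B\<in>parts n m K. block_weight z B)"
  proof (intro sum.cong refl)
    fix K assume "K \<in> {K. K \<in> supercompositions n m \<and> rel n m K \<subseteq> Q}"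
    then have "K \<in> supercompositions n m" by simp
    from prod_list_parts[OF this, of "\<lambda>k. z ^ (k - 1) * fact (k - 1)"]
    show "comp_weight z K = (\<Prod>B\<in>parts n m K. block_weight z B)"
      by (simp add: comp_weight_def block_weight_def)
  qed
  also have "\<dots> = (\<Sum>P\<in>fine_partitions (points n m) Q. \<Prod>B\<in>P. block_weight z B)"
    by (rule sum.reindex_bij_betw[OF bij_betw_parts[OF Q(2) mn]])
  also have "\<dots> = (\<Prod>C\<in>points n m // Q. \<Prod>i<card (C \<inter> points n m). 1 + of_nat i * z)"
    by (rule sum_fine_partitions[OF finite_points Q(1)]) simp
  also have "\<dots> = (\<Prod>C\<in>points n m // Q. \<Prod>i<card C. 1 + of_nat i * z)"
    using Q(1) by (intro prod.cong refl) (metis Int_absorb2 in_quotient_imp_subset)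
  finally show ?thesis .
qed

text \<open>For each class the factors run from 1 to its size, which gives the factorial.\<close>

lemma sum_comp_weight_1:
  assumes Q: "equiv (points n m) Q" "separates_labels n m Q" and mn: "m \<le> n + 1"
  shows "(\<Sum>K | K \<in> supercompositions n m \<and> rel n m K \<subseteq> Q. comp_weight 1 K) =
    (\<Prod>C\<in>points n m // Q. fact (card C))"
  unfolding sum_comp_weight[OF assms]
  by (simp add: fact_prod_Suc atLeast0LessThan add.commute)

text \<open>A class with at least two points has the factor for \<open>i = 1\<close>, which vanishes
  at \<open>z = -1\<close>. If all classes are singletons, only factors with \<open>i = 0\<close>
  occur.\<close>

lemma sum_comp_weight_minus_1:
  assumes Q: "equiv (points n m) Q" "separates_labels n m Q" and mn: "m \<le> n + 1"
  shows "(\<Sum>K | K \<in> supercompositions n m \<and> rel n m K \<subseteq> Q. comp_weight (-1) K) =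
    (if Q \<subseteq> Id then 1 else 0)"
proof (cases "Q \<subseteq> Id")
  case True
  have "card C = 1" if C: "C \<in> points n m // Q" for C
  proof -
    obtain x where x: "x \<in> points n m" "C = Q `` {x}" using C by (rule quotientE)
    then have "C = {x}" using True Q(1) by (auto simp: equiv_def refl_on_def)
    then show ?thesis by simp
  qed
  then show ?thesis using True by (simp add: sum_comp_weight[OF assms])
next
  case False
  then obtain x y where xy: "(x, y) \<in> Q" "x \<noteq> y" by auto
  then have xp: "x \<in> points n m" using equiv_type[OF Q(1)] by auto
  have C: "Q `` {x} \<in> points n m // Q" using xp by (rule quotientI)
  have fin: "finite (points n m // Q)" using Q(1) by (simp add: finite_quotient equiv_type)
  have "{x, y} \<subseteq> Q `` {x}" using xy xp Q(1) by (auto simp: equiv_def refl_on_def)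
  moreover have "finite (Q `` {x})"
    using equiv_type[OF Q(1)] by (auto intro: finite_subset[OF _ finite_points[of n m]])
  ultimately have "2 \<le> card (Q `` {x})"
    using card_mono[of "Q `` {x}" "{x, y}"] xy(2) by simp
  then have "(\<Prod>i<card (Q `` {x}). 1 + of_nat i * (-1 :: rat)) = 0"
    by (intro prod_zero) (auto intro!: bexI[of _ 1])
  then show ?thesis
    using False C fin by (auto simp: sum_comp_weight[OF assms] intro!: prod_zero)
qed

section \<open>The Moebius function\<close>

text \<open>Recognizing the least element as the image of the diagonal makes the results on
  \<open>comp_of\<close> available for it.\<close>

lemma least_comp_eq: "least_comp n m = comp_of n m (Id_on (points n m))"
proof -
  have 1: "insert 0 (Id_on (points n m) `` {n + 1 + i} \<inter> {1..n}) = {0}" for i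
    by auto
  have 2: "Id_on (points n m) `` {j} = {j}" if "j \<in> set [1..<n + 1]" for j
    using that by (auto simp: points_def)
  have "filter (\<lambda>j. \<forall>k\<in>Id_on (points n m) `` {j}. j \<le> k \<and> k \<le> n) [1..<n + 1] = [1..<n + 1]"
    using 2 by (intro filter_True) auto
  moreover have "map (\<lambda>j. Id_on (points n m) `` {j}) [1..<n + 1] = map (\<lambda>j. {j}) [1..<n + 1]"
    using 2 by (intro map_cong refl)
  moreover have "replicate m {0} = map (\<lambda>i. insert 0 (Id_on (points n m) `` {n + 1 + i} \<inter> {1..n})) [0..<m]"
    unfolding 1 by (simp add: map_replicate_const)
  ultimately show ?thesis unfolding least_comp_def comp_of_def by metis
qed

lemma
  assumes "m \<le> n + 1"
  shows least_comp_supercomposition: "least_comp n m \<in> supercompositions n m"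
    and rel_least_comp: "rel n m (least_comp n m) = Id_on (points n m)"
proof -
  have "equiv (points n m) (Id_on (points n m))" "separates_labels n m (Id_on (points n m))"
    by (auto simp: equiv_def refl_on_def sym_def trans_def separates_labels_def)
  then show "least_comp n m \<in> supercompositions n m" "rel n m (least_comp n m) = Id_on (points n m)"
    unfolding least_comp_eq using assms by (rule comp_of_supercomposition, rule rel_comp_of)
qed

lemma supercompositions_le: "K \<in> supercompositions n m \<Longrightarrow> m \<le> n + 1"
  by (simp add: supercompositions_def)

lemma rel_subset_Id_iff:
  assumes "K \<in> supercompositions n m"
  shows "rel n m K \<subseteq> Id \<longleftrightarrow> K = least_comp n m"
proof
  note mn = supercompositions_le[OF assms]
  assume "rel n m K \<subseteq> Id"
  then have "rel n m K = Id_on (points n m)"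
    using equiv_rel[OF assms] by (auto simp: equiv_def refl_on_def)
  then show "K = least_comp n m"
    using rel_inject[OF assms least_comp_supercomposition[OF mn]] rel_least_comp[OF mn] by simp
qed (use rel_least_comp[OF supercompositions_le[OF assms]] in auto)

lemma least_comp_refines:
  assumes "K \<in> supercompositions n m"
  shows "refines m (least_comp n m) K"
proof -
  note mn = supercompositions_le[OF assms]
  have "Id_on (points n m) \<subseteq> rel n m K"
    using equiv_rel[OF assms] by (auto simp: equiv_def refl_on_def)
  then show ?thesis
    using refines_iff_rel_subset[OF least_comp_supercomposition[OF mn] assms] rel_least_comp[OF mn]
    by simp
qed

text \<open>The defining recursion, with the term for \<open>N = L\<close> brought back into the
  sum.\<close>

lemma sum_mobius_left:
  assumes K: "K \<in> supercompositions n m" and L: "L \<in> supercompositions n m" and KL: "refines m K L"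
  shows "(\<Sum>N | N \<in> supercompositions n m \<and> refines m K N \<and> refines m N L. mobius n m K N) =
    (if K = L then 1 else 0)"
proof (cases "K = L")
  case True
  have "{N. N \<in> supercompositions n m \<and> refines m K N \<and> refines m N L} = {K}"
    using True K refines_refl refines_antisym by blast
  then show ?thesis using True by (simp add: mobius.simps)
next
  case False
  let ?A = "{N. N \<in> supercompositions n m \<and> refines m K N \<and> refines m N L \<and> N \<noteq> L}"
  have A: "{N. N \<in> supercompositions n m \<and> refines m K N \<and> refines m N L} = insert L ?A"
    using L KL refines_refl by blast
  have "finite ?A" by (rule finite_subset[OF _ finite_supercompositions]) auto
  then have "(\<Sum>N\<in>insert L ?A. mobius n m K N) = mobius n m K L + (\<Sum>N\<in>?A. mobius n m K N)"
    by (rule sum.insert) simp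
  moreover have "mobius n m K L = - (\<Sum>N\<in>?A. mobius n m K N)"
    by (subst mobius.simps) (use False K L KL in simp)
  ultimately show ?thesis using False by (simp add: A)
qed

text \<open>A one-sided inverse of the zeta function of a finite order is two-sided. Put
  \<open>\<nu> y\<close> for the sum in question. Summing \<open>\<nu>\<close> over the interval
  from \<open>x\<close> to \<open>y\<close> and exchanging sums gives 1 by the hypothesis on
  \<open>\<mu>\<close>. Induction on the size of the interval evaluates all terms except the
  last.\<close>

lemma mobius_right_inverse:
  fixes \<mu> :: "'a \<Rightarrow> 'a \<Rightarrow> 'b::ring_1" and le :: "'a \<Rightarrow> 'a \<Rightarrow> bool"
  assumes S: "finite S" and le_refl: "\<And>x. x \<in> S \<Longrightarrow> le x x"
    and le_trans: "\<And>x y z. \<lbrakk>x \<in> S; y \<in> S; z \<in> S; le x y; le y z\<rbrakk> \<Longrightarrow> le x z"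
    and le_antisym: "\<And>x y. \<lbrakk>x \<in> S; y \<in> S; le x y; le y x\<rbrakk> \<Longrightarrow> x = y"
    and \<mu>: "\<And>x y. \<lbrakk>x \<in> S; y \<in> S; le x y\<rbrakk> \<Longrightarrow>
      (\<Sum>z | z \<in> S \<and> le x z \<and> le z y. \<mu> x z) = (if x = y then 1 else 0)"
    and x: "x \<in> S" and y: "y \<in> S" "le x y"
  shows "(\<Sum>z | z \<in> S \<and> le x z \<and> le z y. \<mu> z y) = (if x = y then 1 else 0)"
  using y
proof (induction "card {z. z \<in> S \<and> le x z \<and> le z y}" arbitrary: y rule: less_induct)
  case less
  let ?I = "\<lambda>x y. {z. z \<in> S \<and> le x z \<and> le z y}"
  define \<nu> where "\<nu> y = (\<Sum>z\<in>?I x y. \<mu> z y)" for y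
  have fin: "finite (?I a b)" for a b using S by (rule finite_subset[rotated]) auto
  have yI: "y \<in> ?I x y" using less.prems le_refl by simp
  have "(\<Sum>u\<in>?I x y. \<nu> u) = (\<Sum>u\<in>?I x y. \<Sum>z | z \<in> ?I x y \<and> le z u. \<mu> z u)"
  proof (intro sum.cong refl)
    fix u assume u: "u \<in> ?I x y"
    then have "?I x u = {z. z \<in> ?I x y \<and> le z u}" using le_trans x less.prems by blast
    then show "\<nu> u = (\<Sum>z | z \<in> ?I x y \<and> le z u. \<mu> z u)" by (simp only: \<nu>_def)
  qed
  also have "\<dots> = (\<Sum>z\<in>?I x y. \<Sum>u | u \<in> ?I x y \<and> le z u. \<mu> z u)"
    by (rule sum.swap_restrict[OF fin fin])
  also have "\<dots> = (\<Sum>z\<in>?I x y. if z = y then 1 else 0)"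
  proof (intro sum.cong refl)
    fix z assume z: "z \<in> ?I x y"
    then have "{u. u \<in> ?I x y \<and> le z u} = ?I z y" using le_trans x by blast
    then show "(\<Sum>u | u \<in> ?I x y \<and> le z u. \<mu> z u) = (if z = y then 1 else 0)"
      using \<mu>[of z y] z less.prems(1) by simp
  qed
  also have "\<dots> = 1" using yI fin[of x y] by (simp only: sum.delta if_True)
  finally have one: "(\<Sum>u\<in>?I x y. \<nu> u) = 1" .
  show ?case
  proof (cases "x = y")
    case True
    then have "?I x y = {y}" using le_antisym le_refl less.prems by blast
    then show ?thesis using one True by (simp add: \<nu>_def)
  next
    case False
    have "\<nu> u = (if u = x then 1 else 0)" if u: "u \<in> ?I x y - {y}" for u
    proof -
      have "?I x u \<subset> ?I x y"
      proof
        show "?I x u \<subseteq> ?I x y" using le_trans u less.prems x by blast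
        show "?I x u \<noteq> ?I x y" using yI u le_antisym less.prems by blast
      qed
      then have "card (?I x u) < card (?I x y)" using fin by (rule psubset_card_mono[rotated])
      then show ?thesis using less.hyps[of u] u unfolding \<nu>_def by auto
    qed
    then have "(\<Sum>u\<in>?I x y - {y}. \<nu> u) = (\<Sum>u\<in>?I x y - {y}. if u = x then 1 else 0)"
      by (rule sum.cong[OF refl])
    also have "\<dots> = 1"
      using False x le_refl less.prems fin[of x y] by (subst sum.delta) auto
    \<comment> \<open>The term at \<open>u = x\<close> already accounts for the total 1.\<close>
    finally have "\<nu> y = 0" using one sum.remove[OF fin yI, of \<nu>] by simp
    then show ?thesis using False by (simp add: \<nu>_def)
  qed
qed

lemma sum_mobius_right:
  assumes K: "K \<in> supercompositions n m" and L: "L \<in> supercompositions n m" and KL: "refines m K L"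
  shows "(\<Sum>N | N \<in> supercompositions n m \<and> refines m K N \<and> refines m N L. mobius n m N L) =
    (if K = L then 1 else 0)"
  using finite_supercompositions refines_refl refines_trans refines_antisym sum_mobius_left K L KL
  by (rule mobius_right_inverse)

text \<open>Summed over all elements below \<open>K\<close>, both sides give 1 if \<open>K\<close>
  is the least element and 0 otherwise. They agree strictly below \<open>K\<close> by induction on
  the number of related pairs, hence also at \<open>K\<close>.\<close>

lemma mobius_least_comp:
  assumes "K \<in> supercompositions n m"
  shows "of_int (mobius n m (least_comp n m) K) = comp_weight (-1) K"
  using assms
proof (induction "card (rel n m K)" arbitrary: K rule: less_induct)
  case less
  note K = less.prems and mn = supercompositions_le[OF less.prems]
  let ?D = "{N. N \<in> supercompositions n m \<and> rel n m N \<subseteq> rel n m K}"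
  let ?mu = "\<lambda>N. of_int (mobius n m (least_comp n m) N) :: rat"
  have D: "{N. N \<in> supercompositions n m \<and> refines m (least_comp n m) N \<and> refines m N K} = ?D"
    using K least_comp_refines refines_iff_rel_subset by blast
  have fin: "finite ?D" by (rule finite_subset[OF _ finite_supercompositions]) auto
  have KD: "K \<in> ?D" using K by simp
  have "(\<Sum>N\<in>?D. ?mu N) = of_int (\<Sum>N\<in>?D. mobius n m (least_comp n m) N)" by simp
  also have "\<dots> = (if K = least_comp n m then 1 else 0)"
    using sum_mobius_left[OF least_comp_supercomposition[OF mn] K least_comp_refines[OF K]]
    unfolding D by auto
  also have "\<dots> = (\<Sum>N\<in>?D. comp_weight (-1) N)"
    using sum_comp_weight_minus_1[OF equiv_rel[OF K] separates_labels_rel[OF K] mn]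
      rel_subset_Id_iff[OF K] by simp
  finally have eq: "(\<Sum>N\<in>?D. ?mu N) = (\<Sum>N\<in>?D. comp_weight (-1) N)" .
  have "(\<Sum>N\<in>?D - {K}. ?mu N) = (\<Sum>N\<in>?D - {K}. comp_weight (-1) N)"
  proof (intro sum.cong refl)
    fix N assume N: "N \<in> ?D - {K}"
    then have "rel n m N \<subset> rel n m K" using rel_inject K by blast
    moreover have "finite (rel n m K)"
      using equiv_type[OF equiv_rel[OF K]] by (rule finite_subset) simp
    ultimately have "card (rel n m N) < card (rel n m K)" by (rule psubset_card_mono[rotated])
    then show "?mu N = comp_weight (-1) N" using less.hyps N by simp
  qed
  then show ?case using eq sum.remove[OF fin KD, of ?mu] sum.remove[OF fin KD, of "comp_weight (-1)"]
    by simp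
qed

lemma comp_weight_pos: "comp_weight 1 K > 0"
  unfolding comp_weight_def block_weight_def by (induction K) auto

lemma comp_weight_minus_1: "comp_weight (-1) K = of_int (block_sign K) * comp_weight 1 K"
  unfolding comp_weight_def block_sign_def block_weight_def by (induction K) auto

lemma block_sign_square: "block_sign K * block_sign K = 1"
  unfolding block_sign_def by (induction K) (auto simp: mult_ac simp flip: power_mult_distrib)

lemma abs_block_sign: "\<bar>block_sign K\<bar> = 1"
  unfolding block_sign_def by (induction K) (auto simp: abs_mult power_abs)

text \<open>The weight at \<open>z = 1\<close> is positive and differs from the one at
  \<open>z = -1\<close> only by the sign of \<open>K\<close>.\<close>

lemma abs_mobius_least_comp:
  assumes "K \<in> supercompositions n m"
  shows "of_int \<bar>mobius n m (least_comp n m) K\<bar> = comp_weight 1 K"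
proof -
  have "of_int \<bar>mobius n m (least_comp n m) K\<bar> = \<bar>of_int (block_sign K)\<bar> * \<bar>comp_weight 1 K\<bar>"
    by (simp add: mobius_least_comp[OF assms] comp_weight_minus_1 abs_mult)
  also have "\<bar>of_int (block_sign K) :: rat\<bar> = 1"
    using abs_block_sign[of K] by (metis of_int_1 of_int_abs)
  finally show ?thesis using comp_weight_pos[of K] by simp
qed

section \<open>Words and their kernels\<close>

text \<open>With \<open>b\<close> placed before \<open>a\<close>, position \<open>x - 1\<close>
  holds the letter of point \<open>x\<close> throughout: a point of \<open>{1..n}\<close> gets an
  entry of \<open>b\<close>, and the label \<open>n + 1 + i\<close> gets
  \<open>a ! i\<close>.\<close>

definition letter :: "word \<Rightarrow> nat \<Rightarrow> nat" where
  "letter = (\<lambda>(a, b) x. (b @ a) ! (x - 1))"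

definition word_kernel :: "nat \<Rightarrow> nat \<Rightarrow> word \<Rightarrow> nat rel" where
  "word_kernel n m v = {(x, y) \<in> points n m \<times> points n m. letter v x = letter v y}"

lemma kernel_iff: "\<lbrakk>x \<in> points n m; y \<in> points n m\<rbrakk> \<Longrightarrow> (x, y) \<in> word_kernel n m v \<longleftrightarrow> letter v x = letter v y"
  by (simp add: word_kernel_def)

lemma letter_x: "\<lbrakk>(a, b) \<in> words n m; j \<in> {1..n}\<rbrakk> \<Longrightarrow> letter (a, b) j = b ! (j - 1)"
  by (auto simp: letter_def words_def nth_append)

lemma letter_theta: "\<lbrakk>(a, b) \<in> words n m; i < m\<rbrakk> \<Longrightarrow> letter (a, b) (n + 1 + i) = a ! i"
  by (auto simp: letter_def words_def nth_append)

lemma equiv_kernel: "equiv (points n m) (word_kernel n m v)"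
  by (auto simp: word_kernel_def equiv_def refl_on_def sym_def trans_def)

text \<open>Words with a repeated theta index vanish in the algebra, so the words that contribute to
  coefficients are covered; see \<open>contributing_distinct\<close>.\<close>

lemma separates_labels_kernel:
  assumes "(a, b) \<in> words n m" "distinct a"
  shows "separates_labels n m (word_kernel n m (a, b))"
  unfolding separates_labels_def
proof (intro allI impI)
  fix i j assume ij: "i < m" "j < m" "(n + 1 + i, n + 1 + j) \<in> word_kernel n m (a, b)"
  then have "letter (a, b) (n + 1 + i) = letter (a, b) (n + 1 + j)"
    unfolding word_kernel_def by blast
  then have "a ! i = a ! j" unfolding letter_theta[OF assms(1) ij(1)] letter_theta[OF assms(1) ij(2)] .
  moreover have "length a = m" using assms(1) by (simp add: words_def)
  ultimately show "i = j" using ij(1,2) assms(2) nth_eq_iff_index_eq by metis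
qed

text \<open>Symmetry reduces the four combinations of letters and labels to three.\<close>

lemma points_pair_cases:
  assumes "x \<in> points n m" "y \<in> points n m" and sym: "\<And>x y. P x y \<Longrightarrow> P y x"
    and "\<And>i j. \<lbrakk>i \<in> {1..n}; j \<in> {1..n}\<rbrakk> \<Longrightarrow> P i j"
    and "\<And>i j. \<lbrakk>i < m; j \<in> {1..n}\<rbrakk> \<Longrightarrow> P (n + 1 + i) j"
    and "\<And>i j. \<lbrakk>i < m; j < m\<rbrakk> \<Longrightarrow> P (n + 1 + i) (n + 1 + j)"
  shows "P x y"
proof -
  have c: "z \<in> {1..n} \<or> (\<exists>j<m. z = n + 1 + j)" if "z \<in> points n m" for z
  proof (cases "z \<le> n")
    case False
    then have "z - n - 1 < m" "z = n + 1 + (z - n - 1)" using that by (auto simp: points_def)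
    then show ?thesis by blast
  qed (use that in \<open>auto simp: points_def\<close>)
  from c[OF assms(1)] show ?thesis
  proof (elim disjE exE conjE)
    assume x: "x \<in> {1..n}"
    from c[OF assms(2)] show ?thesis
    proof (elim disjE exE conjE)
      fix j assume "j < m" "y = n + 1 + j"
      then show ?thesis using sym[OF assms(5)[of j x]] x by simp
    qed (use x assms(4) in simp)
  next
    fix i assume i: "i < m" "x = n + 1 + i"
    from c[OF assms(2)] show ?thesis
    proof (elim disjE exE conjE)
      fix j assume "j < m" "y = n + 1 + j"
      then show ?thesis using assms(6)[of i j] i by simp
    qed (use i assms(5) in simp)
  qed
qed

section \<open>Comparing a supercomposition with the kernel of a word\<close>

context
  fixes n m :: nat and K :: "nat set list"
  assumes K: "K \<in> supercompositions n m"
begin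

lemma rel_letters:
  assumes "i \<in> {1..n}" "j \<in> {1..n}"
  shows "(i, j) \<in> rel n m K \<longleftrightarrow> same_block K i j"
proof -
  have "(i, j) \<in> rel n m K \<longleftrightarrow> (\<exists>l<length K. i \<in> blk n m K l \<and> j \<in> blk n m K l)"
    by (auto simp: rel_def parts_def)
  also have "\<dots> \<longleftrightarrow> (\<exists>l<length K. i \<in> K ! l \<and> j \<in> K ! l)"
    using blk_letter[OF K _ assms(1)] blk_letter[OF K _ assms(2)] by blast
  also have "\<dots> \<longleftrightarrow> same_block K i j"
    unfolding same_block_def by (metis in_set_conv_nth)
  finally show ?thesis .
qed

lemma rel_label_letter:
  assumes "i < m" "j \<in> {1..n}"
  shows "(n + 1 + i, j) \<in> rel n m K \<longleftrightarrow> j \<in> K ! i"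
proof -
  have i: "i < length K" using supercomp_length[OF K] assms by simp
  show ?thesis using rel_blk[OF K i] blk_label[OF K i assms(1)] blk_letter[OF K i assms(2)] by blast
qed

lemma rel_labels:
  assumes "i < m" "j < m"
  shows "(n + 1 + i, n + 1 + j) \<in> rel n m K \<longleftrightarrow> i = j"
proof -
  have i: "i < length K" using supercomp_length[OF K] assms by simp
  show ?thesis using rel_blk[OF K i] blk_label[OF K i] assms by blast
qed

lemma rel_sym: "(x, y) \<in> rel n m K \<Longrightarrow> (y, x) \<in> rel n m K"
  by (auto simp: rel_def)

lemma rel_points: "(x, y) \<in> rel n m K \<Longrightarrow> x \<in> points n m \<and> y \<in> points n m"
  using equiv_type[OF equiv_rel[OF K]] by blast

lemma rel_kernel: "(x, y) \<in> rel n m K \<Longrightarrow> (x, y) \<in> word_kernel n m v \<longleftrightarrow> letter v x = letter v y"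
  using kernel_iff rel_points by blast

lemma fermionic_nonzero:
  assumes "i < m"
  shows "j \<in> K ! i - {0} \<longleftrightarrow> j \<in> K ! i \<and> j \<in> {1..n}"
proof -
  have "i < length K" using supercomp_length[OF K] assms by simp
  from supercomp_block[OF K this] have "K ! i \<subseteq> {0..n}" by blast
  then show ?thesis by (auto simp: Suc_le_eq)
qed

text \<open>Two different labels are never related in \<open>rel n m K\<close>. What remains are
  diagonal pairs, covered by \<open>P_refl\<close>, pairs of a label and a letter, in either order
  by \<open>P_sym\<close>, and pairs of letters. The defining conditions of \<open>p_fun\<close> and
  \<open>e_fun\<close> are both of this shape.\<close>

lemma Ball_rel_iff:
  assumes P_refl: "\<And>x. P x x" and P_sym: "\<And>x y. P x y \<Longrightarrow> P y x"
  shows "(\<forall>(x, y)\<in>rel n m K. P x y) \<longleftrightarrow>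
    (\<forall>i<m. \<forall>j\<in>K ! i - {0}. P (n + 1 + i) j) \<and>
    (\<forall>i\<in>{1..n}. \<forall>j\<in>{1..n}. same_block K i j \<longrightarrow> P i j)" (is "?L \<longleftrightarrow> ?R")
proof
  assume L: ?L
  show ?R
  proof (intro conjI allI ballI impI)
    fix i j assume i: "i < m" and "j \<in> K ! i - {0}"
    then have "j \<in> K ! i" "j \<in> {1..n}" using fermionic_nonzero[OF i] by simp_all
    then have "(n + 1 + i, j) \<in> rel n m K" using rel_label_letter[OF i] by simp
    then show "P (n + 1 + i) j" using L by blast
  next
    fix i j assume "i \<in> {1..n}" "j \<in> {1..n}" "same_block K i j"
    then have "(i, j) \<in> rel n m K" using rel_letters by simp
    then show "P i j" using L by blast
  qed
next
  assume R: ?R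
  have "(x, y) \<in> rel n m K \<longrightarrow> P x y" if "x \<in> points n m" "y \<in> points n m" for x y
    using that
  proof (rule points_pair_cases[where P = "\<lambda>x y. (x, y) \<in> rel n m K \<longrightarrow> P x y"], goal_cases)
    case (1 x y)
    then show ?case using rel_sym[of y x] P_sym[of x y] by blast
  next
    case (2 i j)
    then show ?case using R rel_letters[OF 2] by blast
  next
    case (3 i j)
    then show ?case using R rel_label_letter[OF 3] fermionic_nonzero[OF 3(1), of j] by simp
  next
    case (4 i j)
    then show ?case using rel_labels[OF 4] P_refl by simp
  qed
  then show ?L using rel_points by (intro ballI) (metis case_prodI2)
qed

context
  fixes a b :: "nat list"
  assumes v: "(a, b) \<in> words n m"
begin

text \<open>The right-hand side is the condition on words in \<open>p_fun\<close>. It follows from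
  \<open>Ball_rel_iff\<close> with equality of letters for \<open>P\<close>.\<close>

lemma rel_subset_kernel_iff: "rel n m K \<subseteq> word_kernel n m (a, b) \<longleftrightarrow>
   (\<forall>i<m. \<forall>j\<in>K ! i - {0}. a ! i = b ! (j - 1)) \<and>
   (\<forall>i\<in>{1..n}. \<forall>j\<in>{1..n}. same_block K i j \<longrightarrow> b ! (i - 1) = b ! (j - 1))"
proof -
  have "rel n m K \<subseteq> word_kernel n m (a, b) \<longleftrightarrow> (\<forall>(x, y)\<in>rel n m K. letter (a, b) x = letter (a, b) y)"
    unfolding subset_iff Ball_def split_paired_All prod.case
    using rel_kernel[of _ _ "(a, b)"] by blast
  also have "\<dots> \<longleftrightarrow> (\<forall>i<m. \<forall>j\<in>K ! i - {0}. letter (a, b) (n + 1 + i) = letter (a, b) j) \<and>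
    (\<forall>i\<in>{1..n}. \<forall>j\<in>{1..n}. same_block K i j \<longrightarrow> letter (a, b) i = letter (a, b) j)"
    by (rule Ball_rel_iff) simp_all
  also have "\<dots> \<longleftrightarrow> (\<forall>i<m. \<forall>j\<in>K ! i - {0}. a ! i = b ! (j - 1)) \<and>
   (\<forall>i\<in>{1..n}. \<forall>j\<in>{1..n}. same_block K i j \<longrightarrow> b ! (i - 1) = b ! (j - 1))"
  proof (intro arg_cong2[where f = "(\<and>)"] all_cong ball_cong refl)
    fix i j assume i: "i < m" and "j \<in> K ! i - {0}"
    then have "j \<in> {1..n}" using fermionic_nonzero[OF i] by simp
    then show "letter (a, b) (n + 1 + i) = letter (a, b) j \<longleftrightarrow> a ! i = b ! (j - 1)"
      using letter_x[OF v, of j] letter_theta[OF v i] by simp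
  next
    fix i j assume "i \<in> {1..n}" "j \<in> {1..n}"
    then show "(same_block K i j \<longrightarrow> letter (a, b) i = letter (a, b) j) \<longleftrightarrow>
        (same_block K i j \<longrightarrow> b ! (i - 1) = b ! (j - 1))"
      using letter_x[OF v, of i] letter_x[OF v, of j] by simp
  qed
  finally show ?thesis .
qed

text \<open>The right-hand side is the condition on words in \<open>e_fun\<close>. The guard
  \<open>x \<noteq> y\<close> in \<open>?P\<close> makes it reflexive, as
  \<open>Ball_rel_iff\<close> demands.\<close>

lemma rel_Int_kernel_iff: "rel n m K \<inter> word_kernel n m (a, b) \<subseteq> Id \<longleftrightarrow>
   (\<forall>i<m. \<forall>j\<in>K ! i - {0}. a ! i \<noteq> b ! (j - 1)) \<and>
   (\<forall>i\<in>{1..n}. \<forall>j\<in>{1..n}. i \<noteq> j \<and> same_block K i j \<longrightarrow> b ! (i - 1) \<noteq> b ! (j - 1))"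
proof -
  let ?P = "\<lambda>x y. x \<noteq> y \<longrightarrow> letter (a, b) x \<noteq> letter (a, b) y"
  have "rel n m K \<inter> word_kernel n m (a, b) \<subseteq> Id \<longleftrightarrow> (\<forall>(x, y)\<in>rel n m K. ?P x y)"
    unfolding subset_iff Ball_def split_paired_All prod.case Int_iff pair_in_Id_conv
    using rel_kernel[of _ _ "(a, b)"] by blast
  also have "\<dots> \<longleftrightarrow> (\<forall>i<m. \<forall>j\<in>K ! i - {0}. ?P (n + 1 + i) j) \<and>
    (\<forall>i\<in>{1..n}. \<forall>j\<in>{1..n}. same_block K i j \<longrightarrow> ?P i j)"
    by (rule Ball_rel_iff) auto
  also have "\<dots> \<longleftrightarrow> (\<forall>i<m. \<forall>j\<in>K ! i - {0}. a ! i \<noteq> b ! (j - 1)) \<and>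
   (\<forall>i\<in>{1..n}. \<forall>j\<in>{1..n}. i \<noteq> j \<and> same_block K i j \<longrightarrow> b ! (i - 1) \<noteq> b ! (j - 1))"
  proof (intro arg_cong2[where f = "(\<and>)"] all_cong ball_cong refl)
    fix i j assume i: "i < m" and "j \<in> K ! i - {0}"
    then have "j \<in> {1..n}" using fermionic_nonzero[OF i] by simp
    \<comment> \<open>A label exceeds \<open>n\<close> and so differs from \<open>j\<close>; the
      guard in \<open>?P\<close> disappears.\<close>
    then show "?P (n + 1 + i) j \<longleftrightarrow> a ! i \<noteq> b ! (j - 1)"
      using letter_x[OF v, of j] letter_theta[OF v i] by simp
  next
    fix i j assume "i \<in> {1..n}" "j \<in> {1..n}"
    then show "(same_block K i j \<longrightarrow> ?P i j) \<longleftrightarrow>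
        (i \<noteq> j \<and> same_block K i j \<longrightarrow> b ! (i - 1) \<noteq> b ! (j - 1))"
      using letter_x[OF v, of i] letter_x[OF v, of j] by auto
  qed
  finally show ?thesis .
qed

text \<open>\<open>M_words\<close> does not compare the entries of \<open>a\<close> with each other.
  For pairs of labels the agreement comes from \<open>distinct a\<close>, because
  \<open>rel n m K\<close> keeps labels apart.\<close>

lemma M_words_iff:
  assumes "distinct a"
  shows "(a, b) \<in> M_words n m K \<longleftrightarrow> rel n m K = word_kernel n m (a, b)"
proof
  have points: "i \<in> points n m" if "i \<in> {1..n}" for i using that by (simp add: points_def)
  have labels: "n + 1 + i \<in> points n m" if "i < m" for i using that by (simp add: points_def)
  assume eq: "rel n m K = word_kernel n m (a, b)"
  have theta_x: "a ! i = b ! (j - 1) \<longleftrightarrow> j \<in> K ! i" if "i < m" "j \<in> {1..n}" for i j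
    by (subst rel_label_letter[OF that, symmetric], unfold eq,
        subst kernel_iff[OF labels[OF that(1)] points[OF that(2)]],
        subst letter_theta[OF v that(1)], subst letter_x[OF v that(2)], rule refl)
  have x_x: "b ! (i - 1) = b ! (j - 1) \<longleftrightarrow> same_block K i j" if "i \<in> {1..n}" "j \<in> {1..n}" for i j
    by (subst rel_letters[OF that, symmetric], unfold eq,
        subst kernel_iff[OF points[OF that(1)] points[OF that(2)]],
        subst letter_x[OF v that(1)], subst letter_x[OF v that(2)], rule refl)
  show "(a, b) \<in> M_words n m K"
    unfolding M_words_def mem_Collect_eq prod.case
  proof (intro conjI allI ballI impI)
    show "(a, b) \<in> words n m" by (rule v)
  next
    fix i j assume "i < m" "j \<in> {1..n}"
    then show "a ! i = b ! (j - 1) \<longleftrightarrow> j \<in> K ! i" by (rule theta_x)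
  next
    fix i j assume "i \<in> {1..n}" "j \<in> {1..n}"
    then show "b ! (i - 1) = b ! (j - 1) \<longleftrightarrow> same_block K i j" by (rule x_x)
  qed
next
  assume "(a, b) \<in> M_words n m K"
  then have theta_x: "\<forall>i<m. \<forall>j\<in>{1..n}. a ! i = b ! (j - 1) \<longleftrightarrow> j \<in> K ! i"
    and x_x: "\<forall>i\<in>{1..n}. \<forall>j\<in>{1..n}. b ! (i - 1) = b ! (j - 1) \<longleftrightarrow> same_block K i j"
    unfolding M_words_def mem_Collect_eq prod.case
    by (rule conjunct1[OF conjunct2], rule conjunct2[OF conjunct2])
  have "(x, y) \<in> rel n m K \<longleftrightarrow> letter (a, b) x = letter (a, b) y"
    if "x \<in> points n m" "y \<in> points n m" for x y
    using that
  proof (rule points_pair_cases[where P = "\<lambda>x y. (x, y) \<in> rel n m K \<longleftrightarrow> letter (a, b) x = letter (a, b) y"], goal_cases)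
    case (1 x y)
    have "(x, y) \<in> rel n m K \<longleftrightarrow> (y, x) \<in> rel n m K" by (rule iffI) (erule rel_sym)+
    then show ?case using 1 by (simp only: eq_commute[of "letter (a, b) y"])
  next
    case (2 i j)
    have "b ! (i - 1) = b ! (j - 1) \<longleftrightarrow> same_block K i j" by (rule x_x[rule_format, OF 2])
    then show ?case using rel_letters[OF 2] letter_x[OF v 2(1)] letter_x[OF v 2(2)] by simp
  next
    case (3 i j)
    have "a ! i = b ! (j - 1) \<longleftrightarrow> j \<in> K ! i" by (rule theta_x[rule_format, OF 3])
    then show ?case using rel_label_letter[OF 3] letter_theta[OF v 3(1)] letter_x[OF v 3(2)] by simp
  next
    case (4 i j)
    have "length a = m" using v by (simp add: words_def)
    then have "a ! i = a ! j \<longleftrightarrow> i = j" using 4 assms nth_eq_iff_index_eq by metis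
    then show ?case using rel_labels[OF 4] letter_theta[OF v 4(1)] letter_theta[OF v 4(2)] by simp
  qed
  then have "(x, y) \<in> rel n m K \<longleftrightarrow> (x, y) \<in> word_kernel n m (a, b)" for x y
    using rel_points[of x y] unfolding word_kernel_def by blast
  then show "rel n m K = word_kernel n m (a, b)" by auto
qed

end

end

text \<open>Applying \<open>comp_of\<close> to the kernel yields a candidate, and
  \<open>rel_inject\<close> its uniqueness, so the definite description in \<open>word_comp\<close>
  is meaningful.\<close>

lemma
  assumes v: "(a, b) \<in> words n m" "distinct a" and mn: "m \<le> n + 1"
  shows word_comp_supercomposition: "word_comp n m (a, b) \<in> supercompositions n m"
    and rel_word_comp: "rel n m (word_comp n m (a, b)) = word_kernel n m (a, b)"
proof -
  have K: "comp_of n m (word_kernel n m (a, b)) \<in> supercompositions n m"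
    "rel n m (comp_of n m (word_kernel n m (a, b))) = word_kernel n m (a, b)"
    using equiv_kernel separates_labels_kernel[OF v] mn
    by (rule comp_of_supercomposition, rule rel_comp_of)
  have "word_comp n m (a, b) = comp_of n m (word_kernel n m (a, b))"
    unfolding word_comp_def
  proof (rule the_equality)
    show "comp_of n m (word_kernel n m (a, b)) \<in> supercompositions n m \<and>
        (a, b) \<in> M_words n m (comp_of n m (word_kernel n m (a, b)))"
      using K M_words_iff[OF K(1) v] by simp
  next
    fix L assume L: "L \<in> supercompositions n m \<and> (a, b) \<in> M_words n m L"
    then have "rel n m L = word_kernel n m (a, b)" using M_words_iff v by blast
    then show "L = comp_of n m (word_kernel n m (a, b))" using L K rel_inject by metis
  qed
  then show "word_comp n m (a, b) \<in> supercompositions n m"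
    "rel n m (word_comp n m (a, b)) = word_kernel n m (a, b)" using K by simp_all
qed

section \<open>Meets as intersections of relations\<close>

lemma equiv_Int: "\<lbrakk>equiv A R; equiv A S\<rbrakk> \<Longrightarrow> equiv A (R \<inter> S)"
  unfolding equiv_def refl_on_def by (blast intro: sym_Int trans_Int)

lemma separates_labels_mono: "\<lbrakk>separates_labels n m R; S \<subseteq> R\<rbrakk> \<Longrightarrow> separates_labels n m S"
  by (auto simp: separates_labels_def)

text \<open>The intersection of the two relations again separates labels, hence belongs to a
  supercomposition. Since refinement is inclusion, this is the greatest lower bound that
  \<open>meet\<close> describes.\<close>

lemma
  assumes K: "K \<in> supercompositions n m" and L: "L \<in> supercompositions n m"
  shows meet_supercomposition: "meet n m K L \<in> supercompositions n m"
    and rel_meet: "rel n m (meet n m K L) = rel n m K \<inter> rel n m L"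
proof -
  define N where "N = comp_of n m (rel n m K \<inter> rel n m L)"
  have N: "N \<in> supercompositions n m" "rel n m N = rel n m K \<inter> rel n m L"
    unfolding N_def
    using equiv_Int[OF equiv_rel[OF K] equiv_rel[OF L]]
      separates_labels_mono[OF separates_labels_rel[OF K] Int_lower1] supercompositions_le[OF K]
    by (rule comp_of_supercomposition, rule rel_comp_of)
  have lower: "refines m N' K \<and> refines m N' L \<longleftrightarrow> refines m N' N"
    if "N' \<in> supercompositions n m" for N'
    using refines_iff_rel_subset[OF that K] refines_iff_rel_subset[OF that L]
      refines_iff_rel_subset[OF that N(1)] N(2) by simp
  have "meet n m K L = N"
    unfolding meet_def
  proof (rule the_equality)
    show "N \<in> supercompositions n m \<and> refines m N K \<and> refines m N L \<and>
      (\<forall>N'\<in>supercompositions n m. refines m N' K \<and> refines m N' L \<longrightarrow> refines m N' N)"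
      using lower N(1) refines_refl by blast
  next
    fix N' assume N': "N' \<in> supercompositions n m \<and> refines m N' K \<and> refines m N' L \<and>
      (\<forall>N\<in>supercompositions n m. refines m N K \<and> refines m N L \<longrightarrow> refines m N N')"
    then have "refines m N' N" "refines m N N'" using lower N(1) refines_refl by blast+
    then show "N' = N" using refines_antisym N' N(1) by blast
  qed
  then show "meet n m K L \<in> supercompositions n m"
    "rel n m (meet n m K L) = rel n m K \<inter> rel n m L" using N by simp_all
qed

text \<open>In this form the coefficient depends on the word only through its kernel, which the
  cancellation of words in \<open>h_fun_eq\<close> relies on.\<close>

lemma block_fact_meet_word_comp:
  assumes K: "K \<in> supercompositions n m" and v: "(a, b) \<in> words n m" "distinct a"
  shows "of_nat (block_fact (meet n m K (word_comp n m (a, b)))) =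
    (\<Prod>C\<in>points n m // (rel n m K \<inter> word_kernel n m (a, b)). fact (card C) :: rat)"
proof -
  note mn = supercompositions_le[OF K]
  note L = word_comp_supercomposition[OF v mn] rel_word_comp[OF v mn]
  note N = meet_supercomposition[OF K L(1)] rel_meet[OF K L(1)]
  show ?thesis
    unfolding block_fact_def prod_list_parts[OF N(1)] quotient_rel[OF N(1), symmetric] N(2) L(2)
    by simp
qed

section \<open>Expansions of the functions e and h\<close>

text \<open>A finite index set common to \<open>p\<close>, \<open>e\<close> and \<open>h\<close> at
  a monomial \<open>u\<close>; identities of series then follow by comparing the coefficients of
  words.\<close>

definition contributing :: "nat \<Rightarrow> nat \<Rightarrow> nat set \<times> nat list \<Rightarrow> word set" where
  "contributing n m u = {v \<in> words n m. coeff (eval_word v) u \<noteq> 0}"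

lemma finite_contributing: "finite (contributing n m u)"
  using finite_contributing_words[of n m "fst u" "snd u"] by (simp add: contributing_def)

lemma contributing_distinct:
  "(a, b) \<in> contributing n m u \<Longrightarrow> (a, b) \<in> words n m \<and> distinct a"
  using coeff_eval_word_nonzero[of a b "fst u" "snd u"] by (simp add: contributing_def)

lemma coeff_word_sum_contributing:
  assumes "W \<subseteq> words n m"
  shows "coeff (word_sum W c) u =
    (\<Sum>v\<in>contributing n m u. (if v \<in> W then c v else 0) * coeff (eval_word v) u)"
  unfolding coeff_word_sum[OF assms]
  by (rule sum.mono_neutral_cong_left[OF finite_contributing]) (use assms in \<open>auto simp: contributing_def\<close>)

lemma coeff_p_fun:
  assumes "K \<in> supercompositions n m"
  shows "coeff (p_fun n m K) u =
    (\<Sum>v\<in>contributing n m u. (if rel n m K \<subseteq> word_kernel n m v then 1 else 0) * coeff (eval_word v) u)"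
proof -
  have "coeff (p_fun n m K) u = (\<Sum>v\<in>contributing n m u.
      (if v \<in> {(a, b) \<in> words n m.
     (\<forall>i<m. \<forall>j\<in>K ! i - {0}. a ! i = b ! (j - 1)) \<and>
     (\<forall>i\<in>{1..n}. \<forall>j\<in>{1..n}. same_block K i j \<longrightarrow> b ! (i - 1) = b ! (j - 1))} then 1 else 0) * coeff (eval_word v) u)"
    unfolding p_fun_def by (rule coeff_word_sum_contributing) blast
  also have "\<dots> = (\<Sum>v\<in>contributing n m u. (if rel n m K \<subseteq> word_kernel n m v then 1 else 0) * coeff (eval_word v) u)"
  proof (intro sum.cong refl)
    fix v assume v: "v \<in> contributing n m u"
    obtain a b where ab: "v = (a, b)" by (cases v)
    have w: "(a, b) \<in> words n m" using contributing_distinct v ab by blast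
    show "(if v \<in> {(a, b) \<in> words n m.
     (\<forall>i<m. \<forall>j\<in>K ! i - {0}. a ! i = b ! (j - 1)) \<and>
     (\<forall>i\<in>{1..n}. \<forall>j\<in>{1..n}. same_block K i j \<longrightarrow> b ! (i - 1) = b ! (j - 1))} then 1 else 0) * coeff (eval_word v) u
     = (if rel n m K \<subseteq> word_kernel n m v then 1 else 0) * coeff (eval_word v) u"
      unfolding ab rel_subset_kernel_iff[OF assms w] mem_Collect_eq prod.case by (simp only: w simp_thms)
  qed
  finally show ?thesis .
qed

lemma coeff_e_fun:
  assumes "K \<in> supercompositions n m"
  shows "coeff (e_fun n m K) u =
    (\<Sum>v\<in>contributing n m u. (if rel n m K \<inter> word_kernel n m v \<subseteq> Id then 1 else 0) * coeff (eval_word v) u)"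
proof -
  have "coeff (e_fun n m K) u = (\<Sum>v\<in>contributing n m u.
      (if v \<in> {(a, b) \<in> words n m.
     (\<forall>i<m. \<forall>j\<in>K ! i - {0}. a ! i \<noteq> b ! (j - 1)) \<and>
     (\<forall>i\<in>{1..n}. \<forall>j\<in>{1..n}. i \<noteq> j \<and> same_block K i j \<longrightarrow> b ! (i - 1) \<noteq> b ! (j - 1))} then 1 else 0) * coeff (eval_word v) u)"
    unfolding e_fun_def by (rule coeff_word_sum_contributing) blast
  also have "\<dots> = (\<Sum>v\<in>contributing n m u. (if rel n m K \<inter> word_kernel n m v \<subseteq> Id then 1 else 0) * coeff (eval_word v) u)"
  proof (intro sum.cong refl)
    fix v assume v: "v \<in> contributing n m u"
    obtain a b where ab: "v = (a, b)" by (cases v)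
    have w: "(a, b) \<in> words n m" using contributing_distinct v ab by blast
    show "(if v \<in> {(a, b) \<in> words n m.
     (\<forall>i<m. \<forall>j\<in>K ! i - {0}. a ! i \<noteq> b ! (j - 1)) \<and>
     (\<forall>i\<in>{1..n}. \<forall>j\<in>{1..n}. i \<noteq> j \<and> same_block K i j \<longrightarrow> b ! (i - 1) \<noteq> b ! (j - 1))} then 1 else 0) * coeff (eval_word v) u
     = (if rel n m K \<inter> word_kernel n m v \<subseteq> Id then 1 else 0) * coeff (eval_word v) u"
      unfolding ab rel_Int_kernel_iff[OF assms w] mem_Collect_eq prod.case by (simp only: w simp_thms)
  qed
  finally show ?thesis .
qed

text \<open>After exchanging the sums, a word collects \<open>c K\<close> from those
  \<open>K\<close> whose relation lies both in that of \<open>I\<close> and in the kernel. Merging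
  the two inclusions into one intersection gives the shape of
  \<open>sum_comp_weight\<close>.\<close>

lemma coeff_sum_p_fun:
  assumes I: "I \<in> supercompositions n m"
  shows "coeff (\<Sum>K | K \<in> supercompositions n m \<and> refines m K I. c K *\<^sub>Q p_fun n m K) u =
    (\<Sum>v\<in>contributing n m u.
      (\<Sum>K | K \<in> supercompositions n m \<and> rel n m K \<subseteq> rel n m I \<inter> word_kernel n m v. c K) * coeff (eval_word v) u)"
proof -
  let ?D = "{K. K \<in> supercompositions n m \<and> refines m K I}"
  let ?V = "contributing n m u"
  have fin: "finite ?D" by (rule finite_subset[OF _ finite_supercompositions]) auto
  have "coeff (\<Sum>K\<in>?D. c K *\<^sub>Q p_fun n m K) u =
      (\<Sum>K\<in>?D. \<Sum>v\<in>?V. (if rel n m K \<subseteq> word_kernel n m v then c K else 0) * coeff (eval_word v) u)"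
    unfolding coeff_sum coeff_scale
  proof (intro sum.cong refl)
    fix K assume "K \<in> ?D"
    then show "c K * coeff (p_fun n m K) u =
        (\<Sum>v\<in>?V. (if rel n m K \<subseteq> word_kernel n m v then c K else 0) * coeff (eval_word v) u)"
      by (simp add: coeff_p_fun sum_distrib_left if_distrib[of "\<lambda>x. _ * x"] if_distrib[of "\<lambda>x. x * _"] cong: if_cong)
  qed
  also have "\<dots> = (\<Sum>v\<in>?V. (\<Sum>K\<in>?D. if rel n m K \<subseteq> word_kernel n m v then c K else 0) * coeff (eval_word v) u)"
    unfolding sum_distrib_right by (rule sum.swap)
  also have "\<dots> = (\<Sum>v\<in>?V. (\<Sum>K | K \<in> supercompositions n m \<and> rel n m K \<subseteq> rel n m I \<inter> word_kernel n m v. c K) * coeff (eval_word v) u)"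
  proof -
    have "{K. K \<in> supercompositions n m \<and> rel n m K \<subseteq> rel n m I \<inter> word_kernel n m v} =
        {K \<in> ?D. rel n m K \<subseteq> word_kernel n m v}" for v
      using refines_iff_rel_subset[OF _ I] by blast
    then show ?thesis by (simp only: sum.inter_filter[OF fin])
  qed
  finally show ?thesis .
qed

text \<open>At each word, \<open>sum_comp_weight_minus_1\<close> for the intersection of
  \<open>rel n m I\<close> with the kernel turns the weighted sum into the indicator that this
  intersection is trivial.\<close>

lemma e_fun_eq:
  assumes I: "I \<in> supercompositions n m"
  shows "e_fun n m I =
    (\<Sum>K | K \<in> supercompositions n m \<and> refines m K I. comp_weight (-1) K *\<^sub>Q p_fun n m K)"
proof (rule ncseries_eqI)
  fix R w
  show "coeff (e_fun n m I) (R, w) =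
    coeff (\<Sum>K | K \<in> supercompositions n m \<and> refines m K I. comp_weight (-1) K *\<^sub>Q p_fun n m K) (R, w)"
  proof -
    have "(if rel n m I \<inter> word_kernel n m v \<subseteq> Id then 1 else 0) =
        (\<Sum>K | K \<in> supercompositions n m \<and> rel n m K \<subseteq> rel n m I \<inter> word_kernel n m v. comp_weight (-1) K)" for v
      using sum_comp_weight_minus_1[OF equiv_Int[OF equiv_rel[OF I] equiv_kernel]
        separates_labels_mono[OF separates_labels_rel[OF I] Int_lower1] supercompositions_le[OF I]]
      by simp
    then show ?thesis
      unfolding coeff_e_fun[OF I] coeff_sum_p_fun[OF I] by (simp only: cong: sum.cong)
  qed
qed

section \<open>Signs of theta products and cancellation of words\<close>

text \<open>Each entry passed costs one sign. It matters only that the same sign works for all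
  \<open>i\<close>, hence the quantifiers inside the disjunction.\<close>

lemma theta_commute_prod:
  "(\<forall>i. theta i * prod_list (map theta ys) = prod_list (map theta ys) * theta i) \<or>
   (\<forall>i. theta i * prod_list (map theta ys) = - (prod_list (map theta ys) * theta i))"
proof (induction ys)
  case (Cons y ys)
  let ?P = "prod_list (map theta ys)"
  have *: "theta i * (theta y * ?P) = - (theta y * (theta i * ?P))" for i
    using theta_anticommute[of i y] by (simp flip: mult.assoc)
  from Cons.IH show ?case
  proof
    assume c: "\<forall>i. theta i * ?P = ?P * theta i"
    have "theta i * (theta y * ?P) = - (theta y * ?P * theta i)" for i
      unfolding *[of i] c[rule_format, of i] by (simp add: mult.assoc)
    then show ?thesis by simp
  next
    assume c: "\<forall>i. theta i * ?P = - (?P * theta i)"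
    have "theta i * (theta y * ?P) = theta y * ?P * theta i" for i
      unfolding *[of i] c[rule_format, of i] by (simp add: mult.assoc)
    then show ?thesis by simp
  qed
qed simp

text \<open>Moving the left outer variable past the product costs the same sign on both sides, and
  then a single anticommutation remains.\<close>

lemma theta_prod_swap:
  "theta p * (prod_list (map theta ys) * theta q) = - (theta q * (prod_list (map theta ys) * theta p))"
proof -
  let ?P = "prod_list (map theta ys)"
  have *: "?P * (theta p * theta q) = - (?P * (theta q * theta p))"
    using theta_anticommute[of p q] by simp
  from theta_commute_prod[of ys] show ?thesis
  proof
    assume c: "\<forall>i. theta i * ?P = ?P * theta i"
    have "theta p * (?P * theta q) = ?P * (theta p * theta q)" for p q
      using c by (simp flip: mult.assoc)
    then show ?thesis using * by simp
  next
    assume c: "\<forall>i. theta i * ?P = - (?P * theta i)"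
    have "theta p * (?P * theta q) = - (?P * (theta p * theta q))" for p q
      using c by (simp flip: mult.assoc)
    then show ?thesis using * by simp
  qed
qed

text \<open>Since \<open>s\<close> and \<open>t\<close> occur once each, the renaming just exchanges
  two entries, and \<open>theta_prod_swap\<close> applies to the segment between them. The
  disjunction \<open>pq\<close> covers both orders of occurrence.\<close>

lemma prod_theta_transpose:
  assumes "distinct a" "s \<in> set a" "t \<in> set a" "s \<noteq> t"
  shows "prod_list (map theta (map (transpose s t) a)) = - prod_list (map theta a)"
proof -
  obtain xs p ys q zs where a: "a = xs @ p # ys @ q # zs" and pq: "p = s \<and> q = t \<or> p = t \<and> q = s"
  proof -
    obtain us vs where us: "a = us @ s # vs" using assms(2) by (meson split_list)
    then have "t \<in> set us \<or> t \<in> set vs" using assms(3,4) by auto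
    then show ?thesis
    proof
      assume "t \<in> set us"
      then obtain xs ys where "us = xs @ t # ys" by (meson split_list)
      then show ?thesis using that[of xs t ys s vs] us by simp
    next
      assume "t \<in> set vs"
      then obtain ys zs where "vs = ys @ t # zs" by (meson split_list)
      then show ?thesis using that[of us s ys t zs] us by simp
    qed
  qed
  have id: "map (transpose s t) l = l" if "set l \<subseteq> set xs \<union> set ys \<union> set zs" for l
  proof (rule map_idI)
    fix x assume "x \<in> set l"
    then have "x \<noteq> s" "x \<noteq> t" using that assms(1) a pq by auto
    then show "transpose s t x = x" by simp
  qed
  have "transpose s t p = q" "transpose s t q = p" using pq by auto
  then have "map (transpose s t) a = xs @ q # ys @ p # zs"
    using id[OF Un_upper1[THEN subset_trans, OF Un_upper1]] id[OF Un_upper2[THEN subset_trans, OF Un_upper1]]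
      id[OF Un_upper2] a by simp
  moreover have "prod_list (map theta (xs @ i # ys @ j # zs)) =
      prod_list (map theta xs) * ((theta i * (prod_list (map theta ys) * theta j)) * prod_list (map theta zs))" for i j
    by (simp add: mult.assoc)
  ultimately show ?thesis using theta_prod_swap[of q ys p] a by simp
qed

text \<open>Exchanging two indices of \<open>a\<close> that do not occur in \<open>b\<close> preserves the kernel of the word \<open>(a, b)\<close>
  but reverses its sign.\<close>

lemma sum_two_free_thetas:
  "(\<Sum>v | v \<in> contributing n m u \<and> \<not> card (set (fst v) - set (snd v)) \<le> 1.
      g (word_kernel n m v) * coeff (eval_word v) u) = 0"
proof -
  obtain R w where u: "u = (R, w)" by (cases u)
  define X where "X = {v. v \<in> contributing n m u \<and> \<not> card (set (fst v) - set (snd v)) \<le> 1}"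
  have X: "(a, b) \<in> words n m" "distinct a" "set a = R" "b = w" "coeff (eval_word (a, b)) u \<noteq> 0"
    "\<not> card (R - set w) \<le> 1" if "(a, b) \<in> X" for a b
  proof -
    have v: "(a, b) \<in> words n m" "coeff (eval_word (a, b)) (R, w) \<noteq> 0" "\<not> card (set a - set b) \<le> 1"
      using that by (simp_all add: X_def contributing_def u)
    note ab = coeff_eval_word_nonzero[OF v(2)]
    show "(a, b) \<in> words n m" "distinct a" "set a = R" "b = w" "coeff (eval_word (a, b)) u \<noteq> 0"
      "\<not> card (R - set w) \<le> 1"
      using v ab u by simp_all
  qed
  show ?thesis
  proof (cases "card (R - set w) \<le> 1")
    case True
    have "X = {}"
    proof (rule equals0I)
      fix v assume "v \<in> X"
      then show False using X(6)[of "fst v" "snd v"] True by simp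
    qed
    then show ?thesis unfolding X_def[symmetric] by (simp only: sum.empty)
  next
    case False
    then have fin: "finite (R - set w)" by (metis card.infinite zero_le)
    \<comment> \<open>The monomial determines \<open>set a = R\<close> and \<open>b = w\<close> for
      all words in \<open>X\<close>, so one pair \<open>s\<close>, \<open>t\<close> serves them all
      and \<open>h\<close> is an involution on \<open>X\<close>.\<close>
    then obtain s t where st: "s \<in> R" "t \<in> R" "s \<notin> set w" "t \<notin> set w" "s \<noteq> t"
      using False card_le_Suc0_iff_eq[OF fin] by auto
    define h where "h = (\<lambda>v::word. (map (transpose s t) (fst v), snd v))"
    have neg: "coeff (eval_word (h v)) u = - coeff (eval_word v) u" if v: "v \<in> X" for v
    proof -
      obtain a b where ab: "v = (a, b)" by (cases v)
      have "prod_list (map theta (map (transpose s t) a)) = - prod_list (map theta a)"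
        using X(2,3) v ab st by (intro prod_theta_transpose) auto
      then show ?thesis by (simp add: h_def ab eval_word_def)
    qed
    have kernel: "word_kernel n m (h v) = word_kernel n m v" if v: "v \<in> X" for v
    proof -
      obtain a b where ab: "v = (a, b)" by (cases v)
      have wd: "(a, b) \<in> words n m" and b: "b = w" using X(1,4) v ab by auto
      \<comment> \<open>As \<open>b\<close> avoids \<open>s\<close> and \<open>t\<close>, the map
        \<open>h\<close> renames all letters of the word by one bijection, which preserves equality
        of letters.\<close>
      have "map (transpose s t) b = b"
        using st b by (intro map_idI) (auto simp: transpose_def)
      then have map: "b @ map (transpose s t) a = map (transpose s t) (b @ a)" by simp
      have "letter (h v) x = transpose s t (letter v x)" if x: "x \<in> points n m" for x
      proof -
        have "x - 1 < length (b @ a)" using x wd by (auto simp: points_def words_def)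
        from nth_map[OF this, of "transpose s t"] show ?thesis
          unfolding letter_def h_def ab fst_conv snd_conv prod.case map .
      qed
      moreover have "transpose s t x = transpose s t y \<longleftrightarrow> x = y" for x y
        using inj_transpose[of s t] by (simp add: inj_eq)
      ultimately have "letter (h v) x = letter (h v) y \<longleftrightarrow> letter v x = letter v y"
        if "x \<in> points n m" "y \<in> points n m" for x y using that by simp
      then show ?thesis unfolding word_kernel_def by blast
    qed
    have mem: "h v \<in> X" if v: "v \<in> X" for v
    proof -
      obtain a b where ab: "v = (a, b)" by (cases v)
      note x = X[OF v[unfolded ab]]
      have img: "transpose s t ` R = R" using st by (simp add: transpose_image_eq)
      have "h v \<in> words n m" using x(1,3) img by (simp add: words_def h_def ab)
      moreover have "coeff (eval_word (h v)) u \<noteq> 0" using neg[OF v] x(5) ab by simp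
      moreover have "set (fst (h v)) = R" "snd (h v) = w" using x(3,4) img by (simp_all add: h_def ab)
      ultimately show ?thesis using False by (simp add: X_def contributing_def)
    qed
    have "(\<Sum>v\<in>X. g (word_kernel n m v) * coeff (eval_word v) u) = 0"
    proof (rule sum_involution_eq_0[where h = h])
      fix v assume v: "v \<in> X"
      show "g (word_kernel n m (h v)) * coeff (eval_word (h v)) u + g (word_kernel n m v) * coeff (eval_word v) u = 0"
        using neg[OF v] kernel[OF v] by simp
      show "h v \<in> X" by (rule mem[OF v])
      show "h (h v) = v" by (simp add: h_def comp_def)
      \<comment> \<open>A fixed point of \<open>h\<close> would have a coefficient equal to its own
        negative.\<close>
      have "coeff (eval_word v) u \<noteq> 0" using v by (simp add: X_def contributing_def)
      then show "h v \<noteq> v" using neg[OF v] by auto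
    qed
    then show ?thesis unfolding X_def .
  qed
qed

text \<open>The product of factorials is the weighted sum from \<open>sum_comp_weight_1\<close>. The
  words left out by \<open>h_fun\<close> do occur on the right-hand side, but there their
  contributions cancel by \<open>sum_two_free_thetas\<close>.\<close>

lemma h_fun_eq:
  assumes I: "I \<in> supercompositions n m"
  shows "h_fun n m I =
    (\<Sum>K | K \<in> supercompositions n m \<and> refines m K I. comp_weight 1 K *\<^sub>Q p_fun n m K)"
proof (rule ncseries_eqI)
  fix R w
  let ?V = "contributing n m (R, w)"
  define g where "g = (\<lambda>Q. \<Prod>C\<in>points n m // (rel n m I \<inter> Q). fact (card C) :: rat)"
  let ?few = "\<lambda>v. card (set (fst v) - set (snd v)) \<le> 1"
  let ?f = "\<lambda>v. g (word_kernel n m v) * coeff (eval_word v) (R, w)"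
  have "coeff (h_fun n m I) (R, w) = (\<Sum>v\<in>?V.
      (if v \<in> {(a, b) \<in> words n m. distinct a \<and> card (set a - set b) \<le> 1}
       then rat_of_nat (block_fact (meet n m I (word_comp n m v))) else 0) * coeff (eval_word v) (R, w))"
    unfolding h_fun_def by (rule coeff_word_sum_contributing) blast
  also have "\<dots> = (\<Sum>v\<in>?V. if ?few v then ?f v else 0)"
  proof (intro sum.cong refl)
    fix v assume v: "v \<in> ?V"
    obtain a b where ab: "v = (a, b)" by (cases v)
    have w: "(a, b) \<in> words n m" "distinct a" using contributing_distinct v ab by blast+
    show "(if v \<in> {(a, b) \<in> words n m. distinct a \<and> card (set a - set b) \<le> 1}
       then rat_of_nat (block_fact (meet n m I (word_comp n m v))) else 0) * coeff (eval_word v) (R, w) =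
       (if ?few v then ?f v else 0)"
      using w block_fact_meet_word_comp[OF I w] by (simp add: ab g_def)
  qed
  also have "\<dots> = (\<Sum>v | v \<in> ?V \<and> ?few v. ?f v)"
    by (simp only: sum.inter_filter[OF finite_contributing])
  \<comment> \<open>The excluded words are added back with the same coefficient formula; their sum
    is 0.\<close>
  also have "\<dots> = (\<Sum>v | v \<in> ?V \<and> ?few v. ?f v) + (\<Sum>v | v \<in> ?V \<and> \<not> ?few v. ?f v)"
    by (simp only: sum_two_free_thetas add_0_right)
  also have "\<dots> = (\<Sum>v\<in>?V. ?f v)"
  proof -
    have "?V = {v. v \<in> ?V \<and> ?few v} \<union> {v. v \<in> ?V \<and> \<not> ?few v}" by blast
    moreover have "(\<Sum>v\<in>{v. v \<in> ?V \<and> ?few v} \<union> {v. v \<in> ?V \<and> \<not> ?few v}. ?f v) =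
        (\<Sum>v | v \<in> ?V \<and> ?few v. ?f v) + (\<Sum>v | v \<in> ?V \<and> \<not> ?few v. ?f v)"
      by (rule sum.union_disjoint) (auto intro: finite_subset[OF _ finite_contributing])
    ultimately show ?thesis by metis
  qed
  also have "\<dots> = coeff (\<Sum>K | K \<in> supercompositions n m \<and> refines m K I. comp_weight 1 K *\<^sub>Q p_fun n m K) (R, w)"
    unfolding coeff_sum_p_fun[OF I]
  proof (intro sum.cong refl arg_cong2[where f = "(*)"])
    fix v
    show "g (word_kernel n m v) =
        (\<Sum>K | K \<in> supercompositions n m \<and> rel n m K \<subseteq> rel n m I \<inter> word_kernel n m v. comp_weight 1 K)"
      using sum_comp_weight_1[OF equiv_Int[OF equiv_rel[OF I] equiv_kernel]
        separates_labels_mono[OF separates_labels_rel[OF I] Int_lower1] supercompositions_le[OF I]]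
      by (simp add: g_def)
  qed
  finally show "coeff (h_fun n m I) (R, w) =
    coeff (\<Sum>K | K \<in> supercompositions n m \<and> refines m K I. comp_weight 1 K *\<^sub>Q p_fun n m K) (R, w)" .
qed

section \<open>Moebius inversion and the six identities\<close>

text \<open>Inserting the expansion of each \<open>f K\<close> and exchanging sums, the coefficient
  of \<open>p J\<close> becomes \<open>c J\<close> times the sum of \<open>mobius n m K I\<close>
  over the interval from \<open>J\<close> to \<open>I\<close>. By \<open>sum_mobius_right\<close>
  only \<open>J = I\<close> survives.\<close>

lemma mobius_inversion_series:
  assumes f: "\<And>J. J \<in> supercompositions n m \<Longrightarrow>
      f J = (\<Sum>K | K \<in> supercompositions n m \<and> refines m K J. c K *\<^sub>Q p K)"
    and I: "I \<in> supercompositions n m"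
  shows "(\<Sum>K | K \<in> supercompositions n m \<and> refines m K I. of_int (mobius n m K I) *\<^sub>Q f K) = c I *\<^sub>Q p I"
proof -
  let ?D = "{K. K \<in> supercompositions n m \<and> refines m K I}"
  have fin: "finite ?D" by (rule finite_subset[OF _ finite_supercompositions]) auto
  have ID: "I \<in> ?D" using I refines_refl by blast
  have "(\<Sum>K\<in>?D. of_int (mobius n m K I) *\<^sub>Q f K) =
      (\<Sum>K\<in>?D. \<Sum>J | J \<in> ?D \<and> refines m J K. (of_int (mobius n m K I) * c J) *\<^sub>Q p J)"
  proof (intro sum.cong refl)
    fix K assume K: "K \<in> ?D"
    then have "{J. J \<in> supercompositions n m \<and> refines m J K} = {J. J \<in> ?D \<and> refines m J K}"
      using refines_trans by blast
    then show "of_int (mobius n m K I) *\<^sub>Q f K =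
        (\<Sum>J | J \<in> ?D \<and> refines m J K. (of_int (mobius n m K I) * c J) *\<^sub>Q p J)"
      using f[of K] K by (simp add: ncseries.scale_sum_right)
  qed
  also have "\<dots> = (\<Sum>J\<in>?D. \<Sum>K | K \<in> ?D \<and> refines m J K. (of_int (mobius n m K I) * c J) *\<^sub>Q p J)"
    by (rule sum.swap_restrict[OF fin fin])
  also have "\<dots> = (\<Sum>J\<in>?D. if J = I then c J *\<^sub>Q p J else 0)"
  proof (intro sum.cong refl)
    fix J assume J: "J \<in> ?D"
    have "{K. K \<in> ?D \<and> refines m J K} = {K. K \<in> supercompositions n m \<and> refines m J K \<and> refines m K I}"
      by blast
    then have "(\<Sum>K | K \<in> ?D \<and> refines m J K. of_int (mobius n m K I)) = (if J = I then 1 else 0 :: rat)"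
      using arg_cong[OF sum_mobius_right[of J n m I], of rat_of_int] J I by simp
    moreover have "(\<Sum>K | K \<in> ?D \<and> refines m J K. (of_int (mobius n m K I) * c J) *\<^sub>Q p J) =
        ((\<Sum>K | K \<in> ?D \<and> refines m J K. of_int (mobius n m K I)) * c J) *\<^sub>Q p J"
      unfolding sum_distrib_right ncseries.scale_sum_left ..
    ultimately show "(\<Sum>K | K \<in> ?D \<and> refines m J K. (of_int (mobius n m K I) * c J) *\<^sub>Q p J) =
        (if J = I then c J *\<^sub>Q p J else 0)" by simp
  qed
  also have "\<dots> = c I *\<^sub>Q p I" using sum.delta[OF fin, of I "\<lambda>J. c J *\<^sub>Q p J"] ID by (simp only: if_True)
  finally show ?thesis .
qed

theorem proposition4p14:
  fixes n m :: nat and I :: "nat set list"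
  assumes "I \<in> set_superpartitions n m"
  shows
    "e_fun n m I =
       (\<Sum>K | K \<in> supercompositions n m \<and> refines m K I.
          of_int (mobius n m (least_comp n m) K) *\<^sub>Q p_fun n m K)
     \<and>
     p_fun n m I =
       (1 / of_int (mobius n m (least_comp n m) I)) *\<^sub>Q
       (\<Sum>K | K \<in> supercompositions n m \<and> refines m K I.
          of_int (mobius n m K I) *\<^sub>Q e_fun n m K)
     \<and>
     h_fun n m I =
       (\<Sum>K | K \<in> supercompositions n m \<and> refines m K I.
          of_int \<bar>mobius n m (least_comp n m) K\<bar> *\<^sub>Q p_fun n m K)
     \<and>
     p_fun n m I =
       (1 / of_int \<bar>mobius n m (least_comp n m) I\<bar>) *\<^sub>Q
       (\<Sum>K | K \<in> supercompositions n m \<and> refines m K I.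
          of_int (mobius n m K I) *\<^sub>Q h_fun n m K)
     \<and>
     e_fun n m I =
       (\<Sum>K | K \<in> supercompositions n m \<and> refines m K I.
          of_int (block_sign K) *\<^sub>Q
          (\<Sum>L | L \<in> supercompositions n m \<and> refines m L K.
             of_int (mobius n m L K) *\<^sub>Q h_fun n m L))
     \<and>
     h_fun n m I =
       (\<Sum>K | K \<in> supercompositions n m \<and> refines m K I.
          of_int (block_sign K) *\<^sub>Q
          (\<Sum>L | L \<in> supercompositions n m \<and> refines m L K.
             of_int (mobius n m L K) *\<^sub>Q e_fun n m L))"
proof -
  let ?S = "supercompositions n m" and ?mu = "\<lambda>K. mobius n m (least_comp n m) K"
  have I: "I \<in> ?S" using assms by (simp add: set_superpartitions_def)
  \<comment> \<open>Inversion collapses the inner sums of the last two identities to single terms;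
    at \<open>K = I\<close> it gives the formulas for \<open>p_fun n m I\<close>.\<close>
  have e: "(\<Sum>L | L \<in> ?S \<and> refines m L K. of_int (mobius n m L K) *\<^sub>Q e_fun n m L) =
      comp_weight (-1) K *\<^sub>Q p_fun n m K" if "K \<in> ?S" for K
    using e_fun_eq that by (rule mobius_inversion_series)
  have h: "(\<Sum>L | L \<in> ?S \<and> refines m L K. of_int (mobius n m L K) *\<^sub>Q h_fun n m L) =
      comp_weight 1 K *\<^sub>Q p_fun n m K" if "K \<in> ?S" for K
    using h_fun_eq that by (rule mobius_inversion_series)
  \<comment> \<open>Multiplying by the sign of \<open>K\<close> interchanges the weights at
    \<open>z = -1\<close> and \<open>z = 1\<close>, and thereby the expansions of \<open>e\<close>
    and \<open>h\<close>.\<close>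
  have sign_minus: "of_int (block_sign K) * comp_weight (-1) K = comp_weight 1 K" for K
    using arg_cong[OF block_sign_square[of K], of rat_of_int]
    by (simp add: comp_weight_minus_1 flip: mult.assoc)
  \<comment> \<open>Both values are divided by below, so they must not be 0.\<close>
  have pos: "comp_weight 1 I \<noteq> 0" using comp_weight_pos[of I] by simp
  then have neg: "comp_weight (-1) I \<noteq> 0" using sign_minus[of I] by auto
  show ?thesis
  proof (intro conjI)
    show "e_fun n m I = (\<Sum>K | K \<in> ?S \<and> refines m K I. of_int (?mu K) *\<^sub>Q p_fun n m K)"
      unfolding e_fun_eq[OF I] by (intro sum.cong refl) (simp add: mobius_least_comp)
    show "h_fun n m I = (\<Sum>K | K \<in> ?S \<and> refines m K I. of_int \<bar>?mu K\<bar> *\<^sub>Q p_fun n m K)"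
      unfolding h_fun_eq[OF I] by (intro sum.cong refl) (simp add: abs_mobius_least_comp del: of_int_abs)
    show "p_fun n m I = (1 / of_int (?mu I)) *\<^sub>Q
        (\<Sum>K | K \<in> ?S \<and> refines m K I. of_int (mobius n m K I) *\<^sub>Q e_fun n m K)"
      unfolding e[OF I] mobius_least_comp[OF I] using neg by simp
    show "p_fun n m I = (1 / of_int \<bar>?mu I\<bar>) *\<^sub>Q
        (\<Sum>K | K \<in> ?S \<and> refines m K I. of_int (mobius n m K I) *\<^sub>Q h_fun n m K)"
      unfolding h[OF I] abs_mobius_least_comp[OF I] using pos by simp
    show "e_fun n m I = (\<Sum>K | K \<in> ?S \<and> refines m K I. of_int (block_sign K) *\<^sub>Q
        (\<Sum>L | L \<in> ?S \<and> refines m L K. of_int (mobius n m L K) *\<^sub>Q h_fun n m L))"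
      unfolding e_fun_eq[OF I] by (intro sum.cong refl) (simp add: h comp_weight_minus_1)
    show "h_fun n m I = (\<Sum>K | K \<in> ?S \<and> refines m K I. of_int (block_sign K) *\<^sub>Q
        (\<Sum>L | L \<in> ?S \<and> refines m L K. of_int (mobius n m L K) *\<^sub>Q e_fun n m L))"
      unfolding h_fun_eq[OF I] by (intro sum.cong refl) (simp add: e sign_minus)
  qed
qed

end
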